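(* There exists a constant $C_{1/2}>0$ such that for every standard triangular array $\{\xi_{n,k}\}$ satisfying Feller's negligibility condition, and $\xi$ a standard normally distributed random variable, $$\widetilde{\mathrm{Lin}}_{1/2}(\{\xi_{n,k}\})\le C_{1/2}\limsup_{n\to\infty}K\Big(\xi,\sum_{k=1}^n\xi_{n,k}\Big).$$ Moreover, this holds with some $C_{1/2}\le 30.3$.
   Context: A standard triangular array (STA) is a triangular array $\{\xi_{n,k}\}_{n\ge 1,\,1\le k\le n}$ of real square-integrable random variables such that: (a) for each $n$, $\xi_{n,1},\dots,\xi_{n,n}$ are independent; (b) $\mathbb{E}[\xi_{n,k}]=0$ for all $n,k$; (c) $\sum_{k=1}^n\sigma_{n,k}^2=1$ for all $n$, where $\sigma_{n,k}^2=\mathbb{E}[\xi_{n,k}^2]$. It satisfies Feller's negligibility condition if $\max_{1\le k\le n}\sigma_{n,k}^2\to 0$ as $n\to\infty$. The Kolmogorov distance between random variables is $K(\eta,\eta')=\sup_{x\in\mathbb{R}}|\mathbb{P}[\eta\le x]-\mathbb{P}[\eta'\le x]|$. The relaxed Lindeberg index with parameter $1/2$ is $$\widetilde{\mathrm{Lin}}_{1/2}(\{\xi_{n,k}\})=\limsup_{n\to\infty}\sum_{k=1}^n\mathbb{E}\big[\xi_{n,k}^2\big(1-e^{-\frac12\xi_{n,k}^2}\big)\big].$$ *)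

theory Defs
  imports "HOL-Probability.Probability"
begin

text \<open>
  A triangular array is a function \<open>X n k\<close>, of which only the entries with \<open>1 \<le> k \<le> n\<close> matter.
  Every row \<open>n\<close> may live on its own probability space \<open>M n\<close>; an array on a common space \<open>P\<close> is
  the case \<open>M = (\<lambda>_. P)\<close>.
\<close>

definition standard_triangular_array ::
    "(nat \<Rightarrow> 'a measure) \<Rightarrow> (nat \<Rightarrow> nat \<Rightarrow> 'a \<Rightarrow> real) \<Rightarrow> bool" where
  "standard_triangular_array M X \<longleftrightarrow>
     (\<forall>n\<ge>1.
        prob_space (M n) \<and>
        (\<forall>k\<in>{1..n}. X n k \<in> borel_measurable (M n) \<and> integrable (M n) (\<lambda>\<omega>. (X n k \<omega>)\<^sup>2)) \<and>
        prob_space.indep_vars (M n) (\<lambda>_. borel) (X n) {1..n} \<and>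
        (\<forall>k\<in>{1..n}. (\<integral>\<omega>. X n k \<omega> \<partial>M n) = 0) \<and>
        (\<Sum>k=1..n. (\<integral>\<omega>. (X n k \<omega>)\<^sup>2 \<partial>M n)) = 1)"

text \<open>The value at \<open>n = 0\<close>, a maximum over the empty set, has no influence on the limit.\<close>

definition feller_negligible ::
    "(nat \<Rightarrow> 'a measure) \<Rightarrow> (nat \<Rightarrow> nat \<Rightarrow> 'a \<Rightarrow> real) \<Rightarrow> bool" where
  "feller_negligible M X \<longleftrightarrow>
     (\<lambda>n. MAX k\<in>{1..n}. (\<integral>\<omega>. (X n k \<omega>)\<^sup>2 \<partial>M n)) \<longlonglongrightarrow> 0"

text \<open>
  The two random variables may be defined on different probability spaces. The supremum is one of
  real numbers, taken over a set bounded by 1 when \<open>M\<close> and \<open>N\<close> are probability spaces.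
\<close>

definition kolmogorov_distance ::
    "'a measure \<Rightarrow> ('a \<Rightarrow> real) \<Rightarrow> 'b measure \<Rightarrow> ('b \<Rightarrow> real) \<Rightarrow> real" where
  "kolmogorov_distance M Y N Z =
     (SUP x::real. \<bar>measure M {\<omega> \<in> space M. Y \<omega> \<le> x} - measure N {\<omega> \<in> space N. Z \<omega> \<le> x}\<bar>)"

definition relaxed_Lin_half ::
    "(nat \<Rightarrow> 'a measure) \<Rightarrow> (nat \<Rightarrow> nat \<Rightarrow> 'a \<Rightarrow> real) \<Rightarrow> ereal" where
  "relaxed_Lin_half M X =
     limsup (\<lambda>n. ereal (\<Sum>k=1..n.
       (\<integral>\<omega>. (X n k \<omega>)\<^sup>2 * (1 - exp (- (1/2) * (X n k \<omega>)\<^sup>2)) \<partial>M n)))"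

end

theory Submission
  imports Defs
begin

text \<open>
  The proof is an inverse application of Stein's method. Let \<open>W\<close> be the sum of a row, \<open>W\<^sub>k\<close> the sum without its
  \<open>k\<close>-th term, \<open>K\<close> the Kolmogorov distance of \<open>W\<close> to the standard normal variable \<open>Z\<close>, and
  \<open>f w = (1 - exp (- 3 * w\<^sup>2 / 2)) / w\<close>, called \<open>stein\<close> below. Independence and centring give
  \<open>E (W * f W) = (\<Sum>k. E (X\<^sub>k * (f (W\<^sub>k + X\<^sub>k) - f W\<^sub>k)))\<close>. On the right \<open>X\<^sub>k\<close> and \<open>W\<^sub>k\<close> are independent, and by Feller's
  condition \<open>W\<^sub>k\<close> may be replaced by an independent copy of \<open>W\<close> with vanishing error. Since the variances sum to
  \<open>1\<close>, the identity says that the average of \<open>E (G\<^sub>x W)\<close>, where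
  \<open>G\<^sub>x w = w * f w - (f (w + x) - f w) / x\<close> (\<open>stein_test x w\<close> below), over the probability measure
  \<open>(\<Sum>k. x\<^sup>2 * P (X\<^sub>k \<in> dx))\<close> tends to \<open>0\<close>.

  For the normal variable, however, \<open>E (G\<^sub>x Z) \<ge> 5/24 * (1 - exp (- x\<^sup>2 / 2))\<close>
  (\<open>expectation_stein_test_std_normal\<close>), and the average of the right-hand side is \<open>5/24\<close> times the relaxed
  Lindeberg sum. On the other hand, \<open>E (G\<^sub>x W)\<close> and \<open>E (G\<^sub>x Z)\<close> differ by at most \<open>K\<close> times the total variation of
  \<open>G\<^sub>x\<close> (\<open>expectation_diff_le_cdf_distance\<close>), and this total variation is at most \<open>101/16\<close>, uniformly in \<open>x\<close>
  (\<open>nn_integral_abs_stein_test'\<close>): the part \<open>w * f w\<close> contributes \<open>2\<close> and the difference quotient at most the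
  total variation \<open>69/16\<close> of \<open>f'\<close>. Hence the relaxed Lindeberg sum is at most
  \<open>24/5 * 101/16 * K = 303/10 * K\<close> up to an error that vanishes in the limit (\<open>relaxed_Lindeberg_sum_le\<close>).

  The choice of \<open>f\<close> balances two demands. The surplus \<open>E (G\<^sub>x Z)\<close> should be large, and it can be computed
  because \<open>f\<close> is a mixture of the functions \<open>w * exp (- a * w\<^sup>2 / 2)\<close>; and \<open>w * f w\<close> should be monotone on each half-line,
  which forces a tail like \<open>1 / w\<close>. The range \<open>{0..3}\<close> of \<open>a\<close> is close to optimal, and makes
  \<open>sqrt (1 + a)\<close> rational at both ends. It leaves almost no room: the constant comes out as \<open>303/10\<close>
  only because the negative part of \<open>f'\<close> is bounded rather sharply (\<open>exp_bound_seven_32nds\<close>).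
\<close>

section \<open>Expectations and distribution functions\<close>

text \<open>
  The fundamental theorem of calculus, with the base point \<open>0\<close> rather than \<open>-\<infinity>\<close> so that no limit of \<open>h\<close> is
  involved. The difference of indicators is the signed indicator of the interval between \<open>0\<close> and \<open>w\<close>;
  in this form \<open>w\<close> occurs only inside an indicator and can be integrated out.
\<close>
lemma increment_eq_integral_indicator_difference:
  fixes h h' :: "real \<Rightarrow> real"
  assumes deriv: "\<And>t. (h has_real_derivative h' t) (at t)"
    and cont: "\<And>t. isCont h' t"
  shows "h w - h 0 = (\<integral>t. h' t * (indicator {..<w} t - indicator {..<0} t) \<partial>lborel)"
proof -
  have [measurable]: "h' \<in> borel_measurable borel"
    using cont by (intro borel_measurable_continuous_onI) (simp add: continuous_on_eq_continuous_at)
  show ?thesis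
  proof (cases "0 \<le> w")
    case True
    have "h w - h 0 = (\<integral>t. h' t * indicator {0..w} t \<partial>lborel)"
      using integral_FTC_Icc_real[OF True deriv cont] by simp
    also have "\<dots> = (\<integral>t. h' t * (indicator {..<w} t - indicator {..<0} t) \<partial>lborel)"
      using True cont
      by (intro integral_cong_AE AE_I[where N="{w}"])
         (auto simp: indicator_def)
    finally show ?thesis .
  next
    case False
    then have w: "w \<le> 0" by simp
    have "h 0 - h w = (\<integral>t. h' t * indicator {w..0} t \<partial>lborel)"
      using integral_FTC_Icc_real[OF w deriv cont] by simp
    also have "\<dots> = (\<integral>t. - (h' t * (indicator {..<w} t - indicator {..<0} t)) \<partial>lborel)"
      using w cont
      by (intro integral_cong_AE AE_I[where N="{0}"])
         (auto simp: indicator_def)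
    finally show ?thesis by simp
  qed
qed

text \<open>Averaging the previous formula over \<open>w\<close> turns the indicator of \<open>t < w\<close> into \<open>1 - cdf M t\<close> (Fubini).\<close>
lemma expectation_eq_integral_against_cdf:
  fixes h h' :: "real \<Rightarrow> real"
  assumes M: "real_distribution M"
    and deriv: "\<And>t. (h has_real_derivative h' t) (at t)"
    and cont: "\<And>t. isCont h' t"
    and int: "integrable lborel h'"
  shows "integrable M h"
    and "integrable lborel (\<lambda>t. h' t * (1 - cdf M t - indicator {..<0} t))"
    and "(\<integral>w. h w \<partial>M) = h 0 + (\<integral>t. h' t * (1 - cdf M t - indicator {..<0} t) \<partial>lborel)"
proof -
  interpret real_distribution M by fact
  interpret P: pair_sigma_finite M lborel ..
  have [measurable]: "h' \<in> borel_measurable borel"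
    using int by auto
  let ?k = "\<lambda>w t. h' t * (indicator {..<w} t - indicator {..<0} t)"
  have k: "?k w t = h' t * ((if t < w then 1 else 0) - (if t < 0 then 1 else 0))" for w t
    by (auto simp: indicator_def)
  have meas: "case_prod ?k \<in> borel_measurable (M \<Otimes>\<^sub>M lborel)"
    unfolding k by measurable
  have bound: "integrable (M \<Otimes>\<^sub>M lborel) (\<lambda>(w, t). h' t)"
  proof (rule P.Fubini_integrable)
    show "(\<lambda>(w, t). h' t) \<in> borel_measurable (M \<Otimes>\<^sub>M lborel)" by measurable
  qed (use int in auto)
  have ki: "integrable (M \<Otimes>\<^sub>M lborel) (case_prod ?k)"
    by (rule Bochner_Integration.integrable_bound[OF bound meas]) (auto simp: indicator_def)
  have rep: "h w = h 0 + (\<integral>t. ?k w t \<partial>lborel)" for w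
    using increment_eq_integral_indicator_difference[OF deriv cont, of w] by simp
  have "integrable M (\<lambda>w. \<integral>t. ?k w t \<partial>lborel)"
    using P.integrable_fst[OF ki] .
  then show "integrable M h"
    by (subst Bochner_Integration.integrable_cong[OF refl rep]) auto
  have inner: "(\<integral>w. ?k w t \<partial>M) = h' t * (1 - cdf M t - indicator {..<0} t)" for t
  proof -
    have "(\<integral>w. (indicator {t<..} w - indicator {..<0} t) \<partial>M) = prob {t<..} - indicator {..<0} t"
      using prob_space by (subst Bochner_Integration.integral_diff) (auto simp: emeasure_eq_measure)
    also have "prob {t<..} = 1 - cdf M t"
      unfolding cdf_def by (subst prob_compl[symmetric]) (auto intro!: arg_cong[where f=prob])
    finally have "(\<integral>w. (indicator {..<w} t - indicator {..<0} t) \<partial>M) = 1 - cdf M t - indicator {..<0} t"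
      by (simp add: indicator_def)
    then show ?thesis by simp
  qed
  show "integrable lborel (\<lambda>t. h' t * (1 - cdf M t - indicator {..<0} t))"
    using P.integrable_snd[OF ki] unfolding inner .
  have "(\<integral>w. h w \<partial>M) = (\<integral>w. h 0 + (\<integral>t. ?k w t \<partial>lborel) \<partial>M)"
    by (rule Bochner_Integration.integral_cong[OF refl rep])
  also have "\<dots> = h 0 + (\<integral>w. (\<integral>t. ?k w t \<partial>lborel) \<partial>M)"
    by (subst Bochner_Integration.integral_add) (use \<open>integrable M (\<lambda>w. \<integral>t. ?k w t \<partial>lborel)\<close> prob_space in auto)
  also have "(\<integral>w. (\<integral>t. ?k w t \<partial>lborel) \<partial>M) = (\<integral>t. (\<integral>w. ?k w t \<partial>M) \<partial>lborel)"
    using P.Fubini_integral[OF ki] by simp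
  finally show "(\<integral>w. h w \<partial>M) = h 0 + (\<integral>t. h' t * (1 - cdf M t - indicator {..<0} t) \<partial>lborel)"
    unfolding inner .
qed

text \<open>
  This is how the Kolmogorov distance enters: two laws whose distribution functions differ by at most
  \<open>K\<close> give expectations of \<open>h\<close> that differ by at most \<open>K\<close> times the total variation of \<open>h\<close>.
\<close>
lemma expectation_diff_le_cdf_distance:
  fixes h h' :: "real \<Rightarrow> real"
  assumes M: "real_distribution M" and N: "real_distribution N"
    and K: "\<And>t. \<bar>cdf M t - cdf N t\<bar> \<le> K"
    and deriv: "\<And>t. (h has_real_derivative h' t) (at t)"
    and cont: "\<And>t. isCont h' t"
    and int: "integrable lborel h'" and T: "(\<integral>t. \<bar>h' t\<bar> \<partial>lborel) \<le> T"
  shows "\<bar>(\<integral>w. h w \<partial>M) - (\<integral>w. h w \<partial>N)\<bar> \<le> K * T"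
proof -
  note EM = expectation_eq_integral_against_cdf[OF M deriv cont int]
  note EN = expectation_eq_integral_against_cdf[OF N deriv cont int]
  have K0: "0 \<le> K" using K[of 0] by linarith
  have "(\<integral>w. h w \<partial>M) - (\<integral>w. h w \<partial>N) = (\<integral>t. h' t * (cdf N t - cdf M t) \<partial>lborel)"
    unfolding EM(3) EN(3)
    by (subst add_diff_add, subst Bochner_Integration.integral_diff[OF EM(2) EN(2), symmetric])
       (simp add: algebra_simps)
  moreover have "integrable lborel (\<lambda>t. h' t * (cdf N t - cdf M t))"
    using Bochner_Integration.integrable_diff[OF EM(2) EN(2)] by (simp add: algebra_simps)
  ultimately have "\<bar>(\<integral>w. h w \<partial>M) - (\<integral>w. h w \<partial>N)\<bar> \<le> (\<integral>t. \<bar>h' t * (cdf N t - cdf M t)\<bar> \<partial>lborel)"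
    by (simp add: integral_abs_bound)
  also have "\<dots> \<le> (\<integral>t. K * \<bar>h' t\<bar> \<partial>lborel)"
  proof (rule integral_mono)
    fix t show "\<bar>h' t * (cdf N t - cdf M t)\<bar> \<le> K * \<bar>h' t\<bar>"
      using K[of t] by (simp add: abs_mult abs_minus_commute mult.commute[of K] mult_left_mono)
  qed (use \<open>integrable lborel (\<lambda>t. h' t * (cdf N t - cdf M t))\<close> int in auto)
  also have "\<dots> = K * (\<integral>t. \<bar>h' t\<bar> \<partial>lborel)" by simp
  also have "\<dots> \<le> K * T" using T K0 by (rule mult_left_mono)
  finally show ?thesis .
qed

section \<open>The Stein function and its derivatives\<close>

text \<open>
  The convention \<open>a / 0 = 0\<close> supplies the right value at \<open>0\<close>. The function is odd and equals
  \<open>1/2\<close> times the integral of \<open>w * exp (- a * w\<^sup>2 / 2)\<close> over \<open>a \<in> {0..3}\<close>. The mixture shows smoothness at \<open>0\<close>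
  and makes Gaussian expectations computable; the closed form shows that \<open>w * stein w\<close> is bounded
  and increasing in \<open>\<bar>w\<bar>\<close>, so that its total variation is small.
\<close>
definition stein :: "real \<Rightarrow> real" where
  "stein w = (1 - exp (- (3/2) * w\<^sup>2)) / w"

text \<open>The derivatives are taken under the integral sign of the mixture.\<close>
definition stein' :: "real \<Rightarrow> real" where
  "stein' w = integral {0..3} (\<lambda>a. (1 - a * w\<^sup>2) * exp (- (a * w\<^sup>2 / 2)) / 2)"

definition stein'' :: "real \<Rightarrow> real" where
  "stein'' w = integral {0..3} (\<lambda>a. (a\<^sup>2 * w^3 - 3 * a * w) * exp (- (a * w\<^sup>2 / 2)) / 2)"

lemma times_stein: "w * stein w = 1 - exp (- (3/2) * w\<^sup>2)"
  by (simp add: stein_def)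

lemma stein_0 [simp]: "stein 0 = 0"
  by (simp add: stein_def)

lemma stein_has_integral:
  "((\<lambda>a. w * exp (- (a * w\<^sup>2 / 2)) / 2) has_integral stein w) {0..3}"
proof (cases "w = 0")
  case False
  have "((\<lambda>a. w * exp (- (a * w\<^sup>2 / 2)) / 2) has_integral
      (- exp (- (3 * w\<^sup>2 / 2)) / w - (- exp (- (0 * w\<^sup>2 / 2)) / w))) {0..3}"
    using False
    by (intro fundamental_theorem_of_calculus)
       (auto simp flip: has_real_derivative_iff_has_vector_derivative
             intro!: derivative_eq_intros simp: power2_eq_square)
  then show ?thesis
    by (simp add: stein_def diff_divide_distrib)
qed simp

lemma stein_deriv: "(stein has_real_derivative stein' w) (at w)"
proof -
  have "((\<lambda>w. integral (cbox 0 3) (\<lambda>a. w * exp (- (a * w\<^sup>2 / 2)) / 2)) has_field_derivative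
      integral (cbox 0 3) (\<lambda>a. (1 - a * w\<^sup>2) * exp (- (a * w\<^sup>2 / 2)) / 2)) (at w within UNIV)"
    by (rule leibniz_rule_field_derivative)
       (auto intro!: derivative_eq_intros integrable_continuous_real continuous_intros
          simp: split_beta field_simps power2_eq_square)
  moreover have "(\<lambda>w. integral (cbox 0 3) (\<lambda>a. w * exp (- (a * w\<^sup>2 / 2)) / 2)) = stein"
    using integral_unique[OF stein_has_integral] by (simp only: cbox_interval)
  ultimately show ?thesis by (simp add: stein'_def)
qed

lemma stein'_deriv: "(stein' has_real_derivative stein'' w) (at w)"
proof -
  have "((\<lambda>w. integral (cbox 0 3) (\<lambda>a. (1 - a * w\<^sup>2) * exp (- (a * w\<^sup>2 / 2)) / 2)) has_field_derivative
      integral (cbox 0 3) (\<lambda>a. (a\<^sup>2 * w^3 - 3 * a * w) * exp (- (a * w\<^sup>2 / 2)) / 2)) (at w within UNIV)"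
    by (rule leibniz_rule_field_derivative)
       (auto intro!: derivative_eq_intros integrable_continuous_real continuous_intros
          simp: split_beta field_simps power2_eq_square power3_eq_cube)
  then show ?thesis by (simp add: stein'_def[abs_def] stein''_def)
qed

lemma continuous_stein'': "continuous_on UNIV stein''"
proof -
  have "continuous_on UNIV (\<lambda>w::real. integral (cbox 0 (3::real)) (\<lambda>a. (a\<^sup>2 * w^3 - 3 * a * w) * exp (- (a * w\<^sup>2 / 2)) / 2))"
    by (rule integral_continuous_on_param) (auto intro!: continuous_intros simp: split_beta)
  then show ?thesis by (simp add: stein''_def[abs_def])
qed

lemma continuous_stein: "continuous_on UNIV stein" and continuous_stein': "continuous_on UNIV stein'"
  using stein_deriv stein'_deriv by (auto intro!: continuous_at_imp_continuous_on DERIV_isCont)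

lemma measurable_stein [measurable]:
  "stein \<in> borel_measurable borel" "stein' \<in> borel_measurable borel" "stein'' \<in> borel_measurable borel"
  using continuous_stein continuous_stein' continuous_stein'' by (auto intro: borel_measurable_continuous_onI)

text \<open>
  This bound controls an error that vanishes by Feller's condition, so a crude constant suffices. With \<open>z = a * w\<^sup>2\<close> the integrand is at most \<open>(3 + z)\<^sup>2 / 4 * exp (- z / 2)\<close> in absolute value.
\<close>
lemma abs_stein''_le: "\<bar>stein'' w\<bar> \<le> 9"
proof -
  have "\<bar>(a\<^sup>2 * w^3 - 3 * a * w) * exp (- (a * w\<^sup>2 / 2)) / 2\<bar> \<le> 3" if a: "0 \<le> a" "a \<le> 3" for a
  proof -
    define z where "z = a * w\<^sup>2"
    have z: "0 \<le> z" using a by (simp add: z_def)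
    have "2 * \<bar>w\<bar> \<le> 1 + w\<^sup>2"
      using zero_le_power2[of "\<bar>w\<bar> - 1"] by (simp add: power2_diff)
    then have "a * (2 * \<bar>w\<bar>) \<le> a * (1 + w\<^sup>2)" using a by (intro mult_left_mono)
    then have aw: "2 * (a * \<bar>w\<bar>) \<le> 3 + z" using a by (simp add: z_def algebra_simps)
    have "a\<^sup>2 * w^3 - 3 * a * w = (a * w) * (z - 3)"
      by (simp add: z_def power2_eq_square power3_eq_cube algebra_simps)
    then have "\<bar>a\<^sup>2 * w^3 - 3 * a * w\<bar> = (a * \<bar>w\<bar>) * \<bar>z - 3\<bar>"
      using a by (simp add: abs_mult)
    also have "\<dots> \<le> (3 + z) / 2 * (3 + z)"
      using aw z a by (intro mult_mono) auto
    \<comment> \<open>the second-order Taylor polynomial of \<open>exp (z / 2)\<close>, which lies below the exponential\<close>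
    also have "\<dots> \<le> 6 * (1 + z / 2 + (z / 2)\<^sup>2 / 2)"
      using z by (simp add: power2_eq_square field_simps)
    also have "\<dots> \<le> 6 * exp (z / 2)"
      using exp_lower_Taylor_quadratic[of "z / 2"] z by simp
    finally have "\<bar>a\<^sup>2 * w^3 - 3 * a * w\<bar> * exp (- (z / 2)) \<le> 6 * exp (z / 2) * exp (- (z / 2))"
      by (rule mult_right_mono) simp
    then have "\<bar>a\<^sup>2 * w^3 - 3 * a * w\<bar> * exp (- (z / 2)) \<le> 6"
      by (simp add: mult.assoc flip: exp_add)
    then show ?thesis by (simp add: abs_mult z_def)
  qed
  then have "norm (stein'' w) \<le> 3 * (3 - 0)"
    unfolding stein''_def
    by (intro integral_bound) (auto intro!: continuous_intros)
  then show ?thesis by simp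
qed

text \<open>Replacing the argument \<open>v\<close> by \<open>v + y\<close> changes an increment of \<open>stein\<close> by a second-order quantity.\<close>
lemma stein_mixed_difference:
  "\<bar>(stein (v + x) - stein v) - (stein (v + y + x) - stein (v + y))\<bar> \<le> 9 * (\<bar>x\<bar> * \<bar>y\<bar>)"
proof -
  have lip: "\<bar>stein' s - stein' t\<bar> \<le> 9 * \<bar>s - t\<bar>" for s t
    using field_differentiable_bound[of UNIV stein' stein'' 9 s t] stein'_deriv abs_stein''_le by auto
  have "\<bar>(stein (v + x) - stein v) - (stein (v + y + x) - stein (v + y))\<bar> \<le> (9 * \<bar>x\<bar>) * \<bar>v - (v + y)\<bar>"
  proof -
    have "((\<lambda>t. stein (t + x) - stein t) has_real_derivative stein' (t + x) - stein' t) (at t)" for t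
      by (intro DERIV_diff stein_deriv DERIV_shift[THEN iffD1])
    then show ?thesis
      using field_differentiable_bound[of UNIV "\<lambda>t. stein (t + x) - stein t"
          "\<lambda>t. stein' (t + x) - stein' t" "9 * \<bar>x\<bar>" "v" "v + y"] lip[of "t + x" t for t]
      by (simp add: add_ac)
  qed
  then show ?thesis by simp
qed

lemma abs_stein_le: "\<bar>stein w\<bar> \<le> 2"
proof (cases "\<bar>w\<bar> \<le> 1")
  case True
  have "1 - exp (- (3/2) * w\<^sup>2) \<le> (3/2) * w\<^sup>2"
    using exp_ge_add_one_self[of "- (3/2) * w\<^sup>2"] by simp
  moreover have "0 \<le> 1 - exp (- (3/2) * w\<^sup>2)" by simp
  ultimately have "\<bar>stein w\<bar> \<le> (3/2) * w\<^sup>2 / \<bar>w\<bar>"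
    unfolding stein_def abs_divide by (intro divide_right_mono) auto
  also have "\<dots> = (3/2) * \<bar>w\<bar>" by (cases "w = 0") (auto simp: power2_eq_square field_simps abs_if)
  finally show ?thesis using True by simp
next
  case False
  have "\<bar>1 - exp (- (3/2) * w\<^sup>2)\<bar> \<le> 1" by simp
  then have "\<bar>stein w\<bar> \<le> 1 / 1"
    unfolding stein_def abs_divide using False by (intro frac_le) auto
  then show ?thesis by simp
qed

lemma stein'_closed_form:
  assumes "w \<noteq> 0"
  shows "stein' w = 3 * exp (- (3/2) * w\<^sup>2) - (1 - exp (- (3/2) * w\<^sup>2)) / w\<^sup>2"
proof -
  have "(stein has_real_derivative 3 * exp (- (3/2) * w\<^sup>2) - (1 - exp (- (3/2) * w\<^sup>2)) / w\<^sup>2) (at w)"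
    unfolding stein_def[abs_def] using assms
    by (auto intro!: derivative_eq_intros simp: power2_eq_square field_simps)
  with stein_deriv show ?thesis by (rule DERIV_unique)
qed

lemma stein''_closed_form:
  assumes "0 < w"
  defines "u \<equiv> (3/2) * w\<^sup>2"
  shows "stein'' w = (2 / w^3) * (1 - exp (- u) * (1 + u + 2 * u\<^sup>2))"
proof -
  have "((\<lambda>w. 3 * exp (- (3/2) * w\<^sup>2) - (1 - exp (- (3/2) * w\<^sup>2)) / w\<^sup>2) has_real_derivative
      (2 / w^3) * (1 - exp (- u) * (1 + u + 2 * u\<^sup>2))) (at w)"
    using assms
    by (auto intro!: derivative_eq_intros simp: power2_eq_square power3_eq_cube field_simps)
  then have "(stein' has_real_derivative (2 / w^3) * (1 - exp (- u) * (1 + u + 2 * u\<^sup>2))) (at w)"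
  proof (rule DERIV_cong_ev[THEN iffD1, OF refl _ refl, rotated])
    have "\<forall>\<^sub>F x in nhds w. x \<in> {0<..}"
      using assms by (intro eventually_nhds_in_open) auto
    then show "\<forall>\<^sub>F x in nhds w. 3 * exp (- (3/2) * x\<^sup>2) - (1 - exp (- (3/2) * x\<^sup>2)) / x\<^sup>2 = stein' x"
      by eventually_elim (simp add: stein'_closed_form)
  qed
  with stein'_deriv show ?thesis by (rule DERIV_unique)
qed

lemma stein'_0: "stein' 0 = 3/2"
  by (simp add: stein'_def)

lemma stein''_minus: "stein'' (- w) = - stein'' w"
proof -
  have "stein'' (- w) = integral {0..3} (\<lambda>a. - ((a\<^sup>2 * w^3 - 3 * a * w) * exp (- (a * w\<^sup>2 / 2)) / 2))"
    unfolding stein''_def by (intro integral_cong) (simp add: field_simps)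
  then show ?thesis by (simp add: stein''_def)
qed

section \<open>Total variation of the derivative\<close>

text \<open>
  The constant \<open>7/32\<close> is close to the best possible one (about \<open>0.21825\<close>, attained near \<open>u = 3.21\<close>), and
  the final constant depends on it. At an interior minimum \<open>m\<close> of the right-hand side, \<open>v = 2 * m - 1\<close> satisfies
  \<open>exp m = 32/7 * v\<close>. The minimum can be below \<open>1\<close> only if \<open>7 * v\<^sup>2 - 43 * v + 28 < 0\<close>, which confines \<open>v\<close> to
  the interval from \<open>0.74\<close> to \<open>5.405\<close>. But there convexity keeps the exponential strictly below the line
  \<open>32/7 * v\<close>, because it lies below that line at both ends of the interval.
\<close>
lemma exp_bound_seven_32nds:
  fixes u :: real
  assumes "0 \<le> u"
  shows "1 \<le> (1 + 2 * u) * exp (- u) + 7/32 * u"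
proof (cases "u \<le> 32/7")
  case False
  have "0 \<le> (1 + 2 * u) * exp (- u)" using assms by simp
  then show ?thesis using False by linarith
next
  case True
  define K where "K t = (1 + 2 * t) * exp (- t) + 7/32 * t" for t :: real
  have "continuous_on {0..32/7} K" unfolding K_def by (intro continuous_intros)
  then obtain m where m: "m \<in> {0..32/7}" "\<And>t. t \<in> {0..32/7} \<Longrightarrow> K m \<le> K t"
    using continuous_attains_inf[of "{0..32/7}" K] by auto
  have "1 \<le> K m"
  proof (rule ccontr)
    assume neg: "\<not> 1 \<le> K m"
    have "K 0 = 1" by (simp add: K_def)
    have "1 \<le> K (32/7)" by (simp add: K_def)
    have int: "0 < m" "m < 32/7"
      using m(1) neg \<open>K 0 = 1\<close> \<open>1 \<le> K (32/7)\<close>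
      by (metis atLeastAtMost_iff order.order_iff_strict order.refl)+
    have dK: "(K has_real_derivative ((1 - 2 * m) * exp (- m) + 7/32)) (at m)"
      unfolding K_def[abs_def] by (auto intro!: derivative_eq_intros simp: algebra_simps)
    define d where "d = min m (32/7 - m)"
    have "0 < d" using int by (simp add: d_def)
    moreover have "\<forall>y. \<bar>m - y\<bar> < d \<longrightarrow> K m \<le> K y"
      using m(2) by (auto simp: d_def abs_if split: if_splits)
    ultimately have crit: "(1 - 2 * m) * exp (- m) + 7/32 = 0"
      using DERIV_local_min[OF dK] by blast
    define v where "v = 2 * m - 1"
    have mv: "m = (v + 1) / 2" by (simp add: v_def)
    have vexp: "v * exp (- m) = 7/32" using crit by (simp add: v_def algebra_simps)
    then have "0 < v * exp (- m)" by simp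
    then have v: "0 < v" by (simp add: zero_less_mult_iff)
    have expm: "exp m = 32/7 * v" using vexp by (simp add: exp_minus field_simps)
    have "v * K m = (v + 2) * (v * exp (- m)) + 7/64 * (v * (v + 1))"
      by (simp add: K_def mv field_simps)
    also have "\<dots> = 7/64 * (v\<^sup>2 + 3 * v + 4)"
      unfolding vexp by (simp add: power2_eq_square field_simps)
    finally have "v * K m = 7/64 * (v\<^sup>2 + 3 * v + 4)" .
    moreover have "v * K m < v * 1" using neg v by (intro mult_strict_left_mono) auto
    ultimately have "7/64 * (v\<^sup>2 + 3 * v + 4) < v" by simp
    then have q: "7 * v\<^sup>2 - 43 * v + 28 < 0" by simp
    have lo: "(37/50) < v"
    proof (rule ccontr)
      assume "\<not> (37/50) < v"
      then have "0 \<le> ((37/50) - v) * ((1891/50) - 7 * v)" by (intro mult_nonneg_nonneg) auto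
      also have "\<dots> = 7 * v\<^sup>2 - 43 * v + (279868/10000)" by (simp add: power2_eq_square field_simps)
      finally show False using q by simp
    qed
    have hi: "v < (1081/200)"
    proof (rule ccontr)
      assume "\<not> v < (1081/200)"
      then have "0 \<le> (v - (1081/200)) * (7 * v - (1033/200))" by (intro mult_nonneg_nonneg) auto
      also have "\<dots> = 7 * v\<^sup>2 - 43 * v + (27916825/1000000)" by (simp add: power2_eq_square field_simps)
      finally show False using q by simp
    qed
    have e: "exp 1 < ((27183/10000)::real)" using abs_ge_self[of "exp 1 - 5837465777 / 2147483648 :: real"] e_approx_32 by simp
    have e1: "exp (87/100) < ((169/50)::real)"
    proof -
      have "exp (87/100) \<le> (exp 1 :: real)" by simp
      then show ?thesis using e by linarith
    qed
    have e2: "exp (1281/400) < ((247/10) :: real)"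
    proof -
      have "(1 - (81/3200) :: real) ^ 8 \<le> exp (- (81/3200)) ^ (8 :: nat)"
        using exp_ge_add_one_self[of "- (81/3200) :: real"] by (intro power_mono) auto
      also have "exp (- (81/3200)) ^ (8 :: nat) = exp (- (81/400) :: real)"
        by (simp flip: exp_of_nat_mult)
      finally have "(1 - (81/3200) :: real) ^ 8 \<le> exp (- (81/400))" .
      moreover have "1629/2000 \<le> (1 - (81/3200) :: real) ^ 8" by (simp add: power_divide)
      ultimately have a: "(1629/2000) \<le> exp (- (81/400) :: real)" by linarith
      have "exp 3 = (exp 1 :: real) ^ 3" by (simp flip: exp_of_nat_mult)
      also have "\<dots> \<le> (27183/10000) ^ 3" using e by (intro power_mono) auto
      also have "\<dots> \<le> (200866/10000)" by (simp add: power3_eq_cube)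
      finally have b: "exp 3 \<le> ((200866/10000) :: real)" .
      have "exp (1281/400) * exp (- (81/400)) = (exp 3 :: real)" by (simp flip: exp_add)
      then have "exp (1281/400) * (1629/2000) \<le> ((200866/10000) :: real)"
        using a b mult_left_mono[OF a, of "exp (1281/400)"] by simp
      then show ?thesis by simp
    qed
    \<comment> \<open>\<open>87/100\<close> and \<open>1281/400\<close> are the values of \<open>m\<close> that belong to \<open>v = 37/50\<close> and \<open>v = 1081/200\<close>\<close>
    define t where "t = (m - (87/100)) / (933/400)"
    have t: "0 \<le> t" "t \<le> 1" using lo hi by (auto simp: t_def v_def)
    have mt: "m = (1 - t) * (87/100) + t * (1281/400)" by (simp add: t_def field_simps)
    have "exp m \<le> (1 - t) * exp (87/100) + t * exp (1281/400)"
      using convex_onD[OF exp_convex, of t "(87/100)" "(1281/400)"] t mt by simp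
    also have "\<dots> \<le> (1 - t) * (169/50) + t * (247/10)"
      using e1 e2 t by (intro add_mono mult_left_mono) auto
    also have "\<dots> < (1 - t) * (32/7 * (37/50)) + t * (32/7 * (1081/200))"
    proof -
      have "(1 - t) * (32/7 * (37/50)) + t * (32/7 * (1081/200)) - ((1 - t) * (169/50) + t * (247/10))
          = (1 + 2 * t) / 350"
        by (simp add: field_simps)
      also have "\<dots> > 0" using t by simp
      finally show ?thesis by (simp only: diff_gt_0_iff_gt)
    qed
    also have "\<dots> = 32/7 * v" by (simp add: v_def mt field_simps)
    finally show False using expm by simp
  qed
  also have "K m \<le> K u" using m(2) assms True by simp
  finally show ?thesis by (simp add: K_def)
qed

text \<open>
  By the closed form, the sign of \<open>stein'' w\<close> is that of \<open>1 - p u\<close> with \<open>p u = exp (- u) * (1 + u + 2 * u\<^sup>2)\<close>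
  and \<open>u = (3/2) * w\<^sup>2\<close>. Starting from \<open>p 0 = 1\<close>, the function \<open>p\<close> increases up to \<open>u = 3/2\<close> and then decreases
  to \<open>0\<close>, so it returns to the level \<open>1\<close> exactly once. Hence \<open>stein'\<close> falls on \<open>{0..w\<^sub>0}\<close> and rises afterwards.
\<close>
lemma stein''_sign_change:
  obtains w\<^sub>0 where "0 < w\<^sub>0" "\<And>w. 0 \<le> w \<Longrightarrow> w \<le> w\<^sub>0 \<Longrightarrow> stein'' w \<le> 0" "\<And>w. w\<^sub>0 \<le> w \<Longrightarrow> 0 \<le> stein'' w"
proof -
  define p where "p u = exp (- u) * (1 + u + 2 * u\<^sup>2)" for u :: real
  have dp: "(p has_real_derivative u * (3 - 2 * u) * exp (- u)) (at u)" for u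
    unfolding p_def[abs_def] by (auto intro!: derivative_eq_intros simp: power2_eq_square algebra_simps)
  have up: "p u \<le> p v" if "0 \<le> u" "u \<le> v" "v \<le> 3/2" for u v
    using that by (intro DERIV_nonneg_imp_nondecreasing[OF that(2)]) (auto intro!: exI conjI dp)
  have down: "p v \<le> p u" if "3/2 \<le> u" "u \<le> v" for u v
  proof (rule DERIV_nonpos_imp_nonincreasing[OF that(2)])
    fix t assume "u \<le> t" "t \<le> v"
    then have "t * (3 - 2 * t) * exp (- t) \<le> 0"
      using that by (intro mult_nonpos_nonneg mult_nonneg_nonpos) auto
    then show "\<exists>y. (p has_real_derivative y) (at t) \<and> y \<le> 0" using dp by blast
  qed
  have "p 0 = 1" by (simp add: p_def)
  have "p 10 < 1"
  proof -
    have "(2::real) ^ 10 \<le> exp 1 ^ 10"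
      using exp_ge_add_one_self[of 1] by (intro power_mono) auto
    then have "1024 \<le> exp (10::real)" by (simp flip: exp_of_nat_mult)
    then show ?thesis by (simp add: p_def exp_minus field_simps)
  qed
  have "\<exists>u\<ge>3/2. u \<le> 10 \<and> p u = 1"
    using up[of 0 "3/2"] \<open>p 0 = 1\<close> \<open>p 10 < 1\<close> dp
    by (intro IVT2) (auto intro: DERIV_isCont)
  then obtain u\<^sub>0 where u0: "3/2 \<le> u\<^sub>0" "p u\<^sub>0 = 1" by auto
  have low: "1 \<le> p u" if "0 \<le> u" "u \<le> u\<^sub>0" for u
    using up[of 0 u] down[of u u\<^sub>0] that u0 \<open>p 0 = 1\<close> by (cases "u \<le> 3/2") auto
  have high: "p u \<le> 1" if "u\<^sub>0 \<le> u" for u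
    using down[of u\<^sub>0 u] u0 that by simp
  have closed: "stein'' w = (2 / w^3) * (1 - p ((3/2) * w\<^sup>2))" if "0 < w" for w
    using stein''_closed_form[OF that] by (simp add: p_def)
  define w\<^sub>0 where "w\<^sub>0 = sqrt (2/3 * u\<^sub>0)"
  have w0: "0 < w\<^sub>0" "(3/2) * w\<^sub>0\<^sup>2 = u\<^sub>0" using u0 by (auto simp: w\<^sub>0_def)
  show thesis
  proof
    show "0 < w\<^sub>0" by fact
    show "stein'' w \<le> 0" if "0 \<le> w" "w \<le> w\<^sub>0" for w
    proof (cases "w = 0")
      case False
      have "w\<^sup>2 \<le> w\<^sub>0\<^sup>2" using that by (intro power_mono) auto
      then have "1 \<le> p ((3/2) * w\<^sup>2)" using w0 by (intro low) auto
      then show ?thesis using that False mult_nonneg_nonpos[of "2 / w^3" "1 - p ((3/2) * w\<^sup>2)"] closed[of w] by simp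
    qed (simp add: stein''_def)
    show "0 \<le> stein'' w" if "w\<^sub>0 \<le> w" for w
    proof -
      have "w\<^sub>0\<^sup>2 \<le> w\<^sup>2" using that w0 by (intro power_mono) auto
      then have "p ((3/2) * w\<^sup>2) \<le> 1" using w0 by (intro high) auto
      then show ?thesis using that w0 by (subst closed) auto
    qed
  qed
qed

lemma stein'_ge: "- 21/64 \<le> stein' w"
proof (cases "w = 0")
  case False
  define u where "u = (3/2) * w\<^sup>2"
  have u: "0 < u" using False by (simp add: u_def)
  have "stein' w = 3/2 * ((1 + 2 * u) * exp (- u) - 1) / u"
    using False by (simp add: stein'_closed_form u_def field_simps)
  also have "\<dots> \<ge> 3/2 * (- (7/32) * u) / u"
    using exp_bound_seven_32nds[of u] u by (intro divide_right_mono mult_left_mono) auto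
  finally show ?thesis using u by simp
qed (simp add: stein'_0)

lemma stein'_tendsto_0: "(stein' \<longlongrightarrow> 0) at_top"
proof (rule Lim_null_comparison)
  show "((\<lambda>w. 3 / w\<^sup>2) \<longlongrightarrow> (0::real)) at_top"
    by (intro tendsto_divide_0[OF tendsto_const] filterlim_at_top_imp_at_infinity
          filterlim_pow_at_top filterlim_ident) simp
  show "\<forall>\<^sub>F w in at_top. norm (stein' w) \<le> 3 / w\<^sup>2"
    using eventually_gt_at_top[of "0::real"]
  proof eventually_elim
    case (elim w)
    define u where "u = (3/2) * w\<^sup>2"
    have u: "0 < u" using elim by (simp add: u_def)
    have "u * exp (- u) \<le> exp u * exp (- u)"
      using order_trans[OF _ exp_ge_add_one_self[of u], of u] by (intro mult_right_mono) auto
    then have "u * exp (- u) \<le> 1" by (simp flip: exp_add)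
    moreover have "stein' w = (3/2 * (2 * (u * exp (- u)) + exp (- u) - 1)) / u"
      using elim by (simp add: stein'_closed_form u_def field_simps)
    moreover have "0 \<le> u * exp (- u)" "0 < exp (- u)" "exp (- u) \<le> 1" using u by auto
    moreover have "\<bar>3/2 * (2 * y + z - 1)\<bar> \<le> 9/2" if "0 \<le> y" "y \<le> 1" "0 < z" "z \<le> 1" for y z :: real
      using that by (simp add: abs_le_iff)
    ultimately have "\<bar>3/2 * (2 * (u * exp (- u)) + exp (- u) - 1)\<bar> \<le> 9/2"
      by blast
    then have "\<bar>stein' w\<bar> \<le> 9/2 / u"
      unfolding \<open>stein' w = _\<close> abs_divide using u by (intro divide_mono) auto
    then show ?case by (simp add: u_def field_simps)
  qed
qed

lemma nn_integral_even:
  fixes g :: "real \<Rightarrow> ennreal"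
  assumes [measurable]: "g \<in> borel_measurable borel" and even: "\<And>t. g (- t) = g t"
  shows "(\<integral>\<^sup>+t. g t \<partial>lborel) = 2 * (\<integral>\<^sup>+t. g t * indicator {0..} t \<partial>lborel)"
proof -
  have "(\<integral>\<^sup>+t. g t \<partial>lborel) = (\<integral>\<^sup>+t. g t * indicator {0..} t + g t * indicator {..0} t \<partial>lborel)"
    by (intro nn_integral_cong_AE AE_I[where N="{0}"]) (auto simp: indicator_def)
  also have "\<dots> = (\<integral>\<^sup>+t. g t * indicator {0..} t \<partial>lborel) + (\<integral>\<^sup>+t. g t * indicator {..0} t \<partial>lborel)"
    by (rule nn_integral_add) auto
  also have "(\<integral>\<^sup>+t. g t * indicator {..0} t \<partial>lborel) = (\<integral>\<^sup>+t. g t * indicator {0..} t \<partial>lborel)"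
    by (subst nn_integral_real_affine[where c="-1" and t=0]) (auto simp: even indicator_def intro!: nn_integral_cong)
  finally show ?thesis by (simp add: mult_2)
qed

text \<open>
  \<open>stein'\<close> is even, starts at \<open>3/2\<close>, falls to a value not below \<open>- 21/64\<close> and returns to \<open>0\<close>; its total
  variation is therefore at most \<open>2 * (3/2 + 2 * 21/64) = 69/16\<close>.
\<close>
lemma nn_integral_abs_stein'': "(\<integral>\<^sup>+t. ennreal \<bar>stein'' t\<bar> \<partial>lborel) \<le> ennreal (69/16)"
proof -
  obtain w\<^sub>0 where w0: "0 < w\<^sub>0" "\<And>w. 0 \<le> w \<Longrightarrow> w \<le> w\<^sub>0 \<Longrightarrow> stein'' w \<le> 0" "\<And>w. w\<^sub>0 \<le> w \<Longrightarrow> 0 \<le> stein'' w"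
    using stein''_sign_change by blast
  have "(\<integral>\<^sup>+t. ennreal \<bar>stein'' t\<bar> * indicator {0..} t \<partial>lborel)
      = (\<integral>\<^sup>+t. ennreal (- stein'' t) * indicator {0..w\<^sub>0} t + ennreal (stein'' t) * indicator {w\<^sub>0..} t \<partial>lborel)"
    using w0 by (intro nn_integral_cong_AE AE_I[where N="{w\<^sub>0}"]) (auto simp: indicator_def)
  also have "\<dots> = (\<integral>\<^sup>+t. ennreal (- stein'' t) * indicator {0..w\<^sub>0} t \<partial>lborel)
      + (\<integral>\<^sup>+t. ennreal (stein'' t) * indicator {w\<^sub>0..} t \<partial>lborel)"
    by (rule nn_integral_add) auto
  also have "(\<integral>\<^sup>+t. ennreal (- stein'' t) * indicator {0..w\<^sub>0} t \<partial>lborel) = - stein' w\<^sub>0 - (- stein' 0)"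
    using w0 by (intro nn_integral_FTC_Icc DERIV_minus stein'_deriv) (auto intro!: DERIV_minus stein'_deriv DERIV_subset[OF DERIV_minus[OF stein'_deriv]])
  also have "(\<integral>\<^sup>+t. ennreal (stein'' t) * indicator {w\<^sub>0..} t \<partial>lborel) = 0 - stein' w\<^sub>0"
    using w0 by (intro nn_integral_FTC_atLeast stein'_deriv stein'_tendsto_0) auto
  finally have half: "(\<integral>\<^sup>+t. ennreal \<bar>stein'' t\<bar> * indicator {0..} t \<partial>lborel)
      = ennreal (- stein' w\<^sub>0 - (- stein' 0)) + ennreal (0 - stein' w\<^sub>0)" .
  have mono: "stein' w\<^sub>0 \<le> stein' 0" 
    using w0 by (intro DERIV_nonpos_imp_nonincreasing[of 0 w\<^sub>0]) (auto intro!: exI conjI stein'_deriv)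
  have neg: "ennreal (0 - stein' w\<^sub>0) \<le> ennreal (21/64)"
    using stein'_ge[of w\<^sub>0] by (intro ennreal_leI) simp
  have "ennreal (- stein' w\<^sub>0 - (- stein' 0)) \<le> ennreal (3/2 + 21/64)"
    using stein'_ge[of w\<^sub>0] by (intro ennreal_leI) (simp add: stein'_0)
  then have "(\<integral>\<^sup>+t. ennreal \<bar>stein'' t\<bar> * indicator {0..} t \<partial>lborel) \<le> ennreal (3/2 + 21/64) + ennreal (21/64)"
    unfolding half by (rule add_mono[OF _ neg])
  also have "\<dots> = ennreal (69/32)" by (simp flip: ennreal_plus)
  finally have "2 * (\<integral>\<^sup>+t. ennreal \<bar>stein'' t\<bar> * indicator {0..} t \<partial>lborel) \<le> 2 * ennreal (69/32)"
    by (rule mult_left_mono) simp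
  also have "2 * ennreal (69/32) = ennreal (69/16)"
    by (simp add: ennreal_mult''[symmetric] flip: ennreal_numeral)
  finally show ?thesis
    by (subst nn_integral_even) (auto simp: stein''_minus)
qed

text \<open>
  The total variation of a difference quotient is at most that of the derivative, because the quotient
  is an average of translates of the derivative. Applied with \<open>g = stein'\<close>.
\<close>
lemma nn_integral_shift_difference_le:
  fixes g g' :: "real \<Rightarrow> real"
  assumes deriv: "\<And>t. (g has_real_derivative g' t) (at t)" and cont: "continuous_on UNIV g'"
  shows "(\<integral>\<^sup>+t. ennreal \<bar>g (t + x) - g t\<bar> \<partial>lborel) \<le> ennreal \<bar>x\<bar> * (\<integral>\<^sup>+t. ennreal \<bar>g' t\<bar> \<partial>lborel)"
proof -
  have [measurable]: "g' \<in> borel_measurable borel"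
    using cont by (rule borel_measurable_continuous_onI)
  have pointwise: "ennreal \<bar>g (t + x) - g t\<bar>
      \<le> (\<integral>\<^sup>+s. ennreal \<bar>x\<bar> * ennreal \<bar>g' (t + s * x)\<bar> * indicator {0..1} s \<partial>lborel)" for t
  proof -
    have d: "((\<lambda>s. g (t + s * x)) has_real_derivative x * g' (t + s * x)) (at s)" for s
      by (rule DERIV_cong[OF DERIV_chain2[OF deriv]]) (auto intro!: derivative_eq_intros)
    have c: "isCont (\<lambda>s. x * g' (t + s * x)) s" for s
    proof -
      have "continuous_on UNIV (\<lambda>s. x * g' (t + s * x))"
        by (intro continuous_intros continuous_on_compose2[OF cont]) auto
      then show ?thesis by (simp add: continuous_on_eq_continuous_at)
    qed
    have "has_bochner_integral lborel (\<lambda>s. x * g' (t + s * x) * indicator {0..1} s)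
        (g (t + 1 * x) - g (t + 0 * x))"
      by (rule has_bochner_integral_FTC_Icc_real[OF _ d c]) simp
    then have "integrable lborel (\<lambda>s. x * g' (t + s * x) * indicator {0..1} s)"
      "(\<integral>s. x * g' (t + s * x) * indicator {0..1} s \<partial>lborel) = g (t + x) - g t"
      by (auto simp: has_bochner_integral_iff)
    then have "ennreal \<bar>g (t + x) - g t\<bar> \<le> (\<integral>\<^sup>+s. ennreal (norm (x * g' (t + s * x) * indicator {0..1} s)) \<partial>lborel)"
      using integral_norm_bound_ennreal by fastforce
    also have "\<dots> = (\<integral>\<^sup>+s. ennreal \<bar>x\<bar> * ennreal \<bar>g' (t + s * x)\<bar> * indicator {0..1} s \<partial>lborel)"
      by (intro nn_integral_cong) (auto simp: indicator_def abs_mult ennreal_mult)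
    finally show ?thesis .
  qed
  have "(\<integral>\<^sup>+t. ennreal \<bar>g (t + x) - g t\<bar> \<partial>lborel)
      \<le> (\<integral>\<^sup>+t. (\<integral>\<^sup>+s. ennreal \<bar>x\<bar> * ennreal \<bar>g' (t + s * x)\<bar> * indicator {0..1} s \<partial>lborel) \<partial>lborel)"
    by (intro nn_integral_mono pointwise)
  also have "\<dots> = (\<integral>\<^sup>+s. (\<integral>\<^sup>+t. ennreal \<bar>x\<bar> * ennreal \<bar>g' (t + s * x)\<bar> * indicator {0..1} s \<partial>lborel) \<partial>lborel)"
    by (rule lborel_pair.Fubini') measurable
  also have "\<dots> = (\<integral>\<^sup>+s. ennreal \<bar>x\<bar> * (\<integral>\<^sup>+t. ennreal \<bar>g' t\<bar> \<partial>lborel) * indicator {0..1::real} s \<partial>lborel)"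
  proof (intro nn_integral_cong)
    fix s :: real
    have "(\<integral>\<^sup>+t. ennreal \<bar>g' t\<bar> \<partial>lborel) = (\<integral>\<^sup>+t. ennreal \<bar>g' (t + s * x)\<bar> \<partial>lborel)"
      by (subst nn_integral_real_affine[where c=1 and t="s * x"]) (auto simp: add_ac)
    then show "(\<integral>\<^sup>+t. ennreal \<bar>x\<bar> * ennreal \<bar>g' (t + s * x)\<bar> * indicator {0..1} s \<partial>lborel)
        = ennreal \<bar>x\<bar> * (\<integral>\<^sup>+t. ennreal \<bar>g' t\<bar> \<partial>lborel) * indicator {0..1} s"
      by (simp add: nn_integral_cmult nn_integral_multc)
  qed
  also have "\<dots> = ennreal \<bar>x\<bar> * (\<integral>\<^sup>+t. ennreal \<bar>g' t\<bar> \<partial>lborel)"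
    by (simp add: nn_integral_cmult)
  finally show ?thesis .
qed

section \<open>The test functions\<close>

text \<open>
  \<open>stein_test x\<close> compares \<open>w * stein w\<close> with the difference quotient of step \<open>x\<close>. As \<open>x\<close> tends to \<open>0\<close> it becomes
  the Stein operator \<open>w * stein w - stein' w\<close>, which has mean \<open>0\<close> under the normal law; for other \<open>x\<close> the
  normal mean is strictly positive, and it is this surplus that measures the jumps of size \<open>x\<close>.
\<close>
definition stein_test :: "real \<Rightarrow> real \<Rightarrow> real" where
  "stein_test x w = w * stein w - (stein (w + x) - stein w) / x"

definition stein_test' :: "real \<Rightarrow> real \<Rightarrow> real" where
  "stein_test' x w = 3 * w * exp (- (3/2) * w\<^sup>2) - (stein' (w + x) - stein' w) / x"

lemma stein_test_deriv: "(stein_test x has_real_derivative stein_test' x w) (at w)"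
proof -
  have "((\<lambda>w. 1 - exp (- (3/2) * w\<^sup>2)) has_real_derivative 3 * w * exp (- (3/2) * w\<^sup>2)) (at w)"
    by (auto intro!: derivative_eq_intros)
  moreover have "((\<lambda>w. stein (w + x)) has_real_derivative stein' (w + x)) (at w)"
    using DERIV_shift stein_deriv by blast
  ultimately show ?thesis
    unfolding stein_test_def[abs_def] stein_test'_def times_stein
    by (intro DERIV_diff DERIV_cdivide stein_deriv)
qed

lemma isCont_stein_test': "isCont (stein_test' x) w"
proof -
  have "continuous_on UNIV (stein_test' x)"
    unfolding stein_test'_def[abs_def] divide_inverse
    by (intro continuous_intros continuous_on_compose2[OF continuous_stein']) auto
  then show ?thesis by (simp add: continuous_on_eq_continuous_at)
qed

text \<open>
  The part \<open>w * stein w\<close> rises from \<open>0\<close> to \<open>1\<close> on both sides of the origin and contributes \<open>2\<close>, the difference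
  quotient contributes at most \<open>69/16\<close>.
\<close>
lemma nn_integral_abs_stein_test':
  assumes "x \<noteq> 0"
  shows "(\<integral>\<^sup>+t. ennreal \<bar>stein_test' x t\<bar> \<partial>lborel) \<le> ennreal (101/16)"
proof -
  have exp_lim: "((\<lambda>w. - exp (- (3/2) * w\<^sup>2)) \<longlongrightarrow> (- 0::real)) at_top"
    by (intro tendsto_minus exp_at_bot[THEN filterlim_compose] filterlim_tendsto_neg_mult_at_bot[OF tendsto_const]
        filterlim_pow_at_top filterlim_ident) auto
  have "(\<integral>\<^sup>+t. ennreal \<bar>3 * t * exp (- (3/2) * t\<^sup>2)\<bar> * indicator {0..} t \<partial>lborel)
      = (\<integral>\<^sup>+t. ennreal (3 * t * exp (- (3/2) * t\<^sup>2)) * indicator {0..} t \<partial>lborel)"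
    by (intro nn_integral_cong) (auto simp: indicator_def)
  also have "\<dots> = ennreal (- 0 - (- exp (- (3/2) * 0\<^sup>2)))"
    by (rule nn_integral_FTC_atLeast[OF _ _ _ exp_lim]) (auto intro!: derivative_eq_intros)
  finally have half: "(\<integral>\<^sup>+t. ennreal \<bar>3 * t * exp (- (3/2) * t\<^sup>2)\<bar> * indicator {0..} t \<partial>lborel) = 1"
    by simp
  have A: "(\<integral>\<^sup>+t. ennreal \<bar>3 * t * exp (- (3/2) * t\<^sup>2)\<bar> \<partial>lborel) = 2"
    by (subst nn_integral_even) (simp_all only: half, simp_all)
  have "ennreal \<bar>(stein' (t + x) - stein' t) / x\<bar> = ennreal (1 / \<bar>x\<bar>) * ennreal \<bar>stein' (t + x) - stein' t\<bar>" for t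
    by (simp flip: ennreal_mult)
  then have "(\<integral>\<^sup>+t. ennreal \<bar>(stein' (t + x) - stein' t) / x\<bar> \<partial>lborel)
      = ennreal (1 / \<bar>x\<bar>) * (\<integral>\<^sup>+t. ennreal \<bar>stein' (t + x) - stein' t\<bar> \<partial>lborel)"
    by (simp add: nn_integral_cmult)
  also have "\<dots> \<le> ennreal (1 / \<bar>x\<bar>) * (ennreal \<bar>x\<bar> * ennreal (69/16))"
    by (intro mult_left_mono order_trans[OF nn_integral_shift_difference_le[OF stein'_deriv continuous_stein'']]
        nn_integral_abs_stein'') auto
  also have "\<dots> = ennreal (69/16)"
    using assms by (simp flip: ennreal_mult)
  finally have B: "(\<integral>\<^sup>+t. ennreal \<bar>(stein' (t + x) - stein' t) / x\<bar> \<partial>lborel) \<le> ennreal (69/16)" .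
  have "(\<integral>\<^sup>+t. ennreal \<bar>stein_test' x t\<bar> \<partial>lborel)
      \<le> (\<integral>\<^sup>+t. ennreal \<bar>3 * t * exp (- (3/2) * t\<^sup>2)\<bar> + ennreal \<bar>(stein' (t + x) - stein' t) / x\<bar> \<partial>lborel)"
    unfolding stein_test'_def by (intro nn_integral_mono) (simp flip: ennreal_plus del: abs_divide add: abs_triangle_ineq4)
  also have "\<dots> = (\<integral>\<^sup>+t. ennreal \<bar>3 * t * exp (- (3/2) * t\<^sup>2)\<bar> \<partial>lborel)
      + (\<integral>\<^sup>+t. ennreal \<bar>(stein' (t + x) - stein' t) / x\<bar> \<partial>lborel)"
    by (rule nn_integral_add) auto
  also have "\<dots> \<le> ennreal 2 + ennreal (69/16)"
    unfolding A using B by (intro add_mono) auto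
  also have "\<dots> = ennreal (101/16)" by (subst ennreal_plus[symmetric]) auto
  finally show ?thesis .
qed

lemma integrable_stein_test':
  assumes "x \<noteq> 0"
  shows "integrable lborel (stein_test' x)" and "(\<integral>t. \<bar>stein_test' x t\<bar> \<partial>lborel) \<le> 101/16"
proof -
  have [measurable]: "stein_test' x \<in> borel_measurable borel"
    using isCont_stein_test' by (intro borel_measurable_continuous_onI) (simp add: continuous_on_eq_continuous_at)
  show "integrable lborel (stein_test' x)"
    using nn_integral_abs_stein_test'[OF assms] by (auto intro!: integrableI_bounded simp: le_less_trans)
  show "(\<integral>t. \<bar>stein_test' x t\<bar> \<partial>lborel) \<le> 101/16"
    using enn2real_mono[OF nn_integral_abs_stein_test'[OF assms]]
    by (subst integral_eq_nn_integral) auto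
qed

section \<open>Gaussian expectations\<close>

abbreviation std_normal :: "real measure" where
  "std_normal \<equiv> density lborel std_normal_density"

lemma real_distribution_std_normal: "real_distribution std_normal"
  using prob_space_normal_density[of 1 0] by (intro real_distribution.intro real_distribution_axioms.intro) auto

text \<open>Completing the square: damping a Gaussian by another Gaussian yields a multiple of a third one.\<close>
lemma normal_density_tilt:
  assumes "0 \<le> a"
  shows "std_normal_density z * exp (- (a * (z + x)\<^sup>2 / 2)) =
    exp (- (a / (1 + a) * x\<^sup>2 / 2)) / sqrt (1 + a) * normal_density (- (a * x / (1 + a))) (1 / sqrt (1 + a)) z"
proof -
  define c where "c = x / (1 + a)"
  have x: "x = c * (1 + a)" using assms by (simp add: c_def)
  have "- z\<^sup>2 / 2 + - (a * (z + x)\<^sup>2 / 2) = - (a * c * x / 2) + - ((z + a * c)\<^sup>2 * (1 + a) / 2)"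
    unfolding x by (simp add: power2_eq_square field_simps)
  also have "a * c * x / 2 = a / (1 + a) * x\<^sup>2 / 2"
    by (simp add: c_def power2_eq_square)
  also have "- ((z + a * c)\<^sup>2 * (1 + a) / 2) = - (z - - (a * x / (1 + a)))\<^sup>2 / (2 * (1 / sqrt (1 + a))\<^sup>2)"
    using assms by (simp add: c_def power_divide)
  finally have "- z\<^sup>2 / 2 + - (a * (z + x)\<^sup>2 / 2) =
      - (a / (1 + a) * x\<^sup>2 / 2) + - (z - - (a * x / (1 + a)))\<^sup>2 / (2 * (1 / sqrt (1 + a))\<^sup>2)" .
  then have "exp (- z\<^sup>2 / 2) * exp (- (a * (z + x)\<^sup>2 / 2)) =
      exp (- (a / (1 + a) * x\<^sup>2 / 2)) * exp (- (z - - (a * x / (1 + a)))\<^sup>2 / (2 * (1 / sqrt (1 + a))\<^sup>2))"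
    by (simp only: exp_add[symmetric])
  then show ?thesis
    using assms
    by (simp add: normal_density_def real_sqrt_mult real_sqrt_divide power_divide divide_simps)
qed

lemma expectation_shifted_gaussian_wave:
  assumes "0 \<le> a"
  shows "(\<integral>z. (z + x) * exp (- (a * (z + x)\<^sup>2 / 2)) / 2 \<partial>std_normal) =
    x * (exp (- (a / (1 + a) * x\<^sup>2 / 2)) / (2 * (1 + a) * sqrt (1 + a)))"
proof -
  let ?d = "normal_density (- (a * x / (1 + a))) (1 / sqrt (1 + a))"
  let ?c = "exp (- (a / (1 + a) * x\<^sup>2 / 2)) / (2 * sqrt (1 + a))"
  have pos: "0 < 1 / sqrt (1 + a)" using assms by simp
  have "(\<integral>z. (z + x) * exp (- (a * (z + x)\<^sup>2 / 2)) / 2 \<partial>std_normal)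
      = (\<integral>z. std_normal_density z * ((z + x) * exp (- (a * (z + x)\<^sup>2 / 2)) / 2) \<partial>lborel)"
    by (subst integral_density) auto
  also have "\<dots> = (\<integral>z. ?c * (?d z * z + x * ?d z) \<partial>lborel)"
  proof (intro Bochner_Integration.integral_cong refl)
    fix z
    have "std_normal_density z * ((z + x) * exp (- (a * (z + x)\<^sup>2 / 2)) / 2)
        = (std_normal_density z * exp (- (a * (z + x)\<^sup>2 / 2))) * (z + x) / 2" by simp
    also have "\<dots> = ?c * (?d z * (z + x))"
      unfolding normal_density_tilt[OF assms] by simp
    also have "?d z * (z + x) = ?d z * z + x * ?d z" by (simp add: algebra_simps)
    finally show "std_normal_density z * ((z + x) * exp (- (a * (z + x)\<^sup>2 / 2)) / 2) = ?c * (?d z * z + x * ?d z)" .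
  qed
  also have "\<dots> = ?c * (- (a * x / (1 + a)) + x)"
    using integrable_normal_moment_nz_1[OF pos] integrable_normal_density[OF pos]
    by (simp add: integral_normal_moment_nz_1[OF pos] integral_normal_density[OF pos])
  also have "- (a * x / (1 + a)) + x = x / (1 + a)" using assms by (simp add: field_simps)
  also have "?c * (x / (1 + a)) = x * (exp (- (a / (1 + a) * x\<^sup>2 / 2)) / (2 * (1 + a) * sqrt (1 + a)))"
    by (simp only: times_divide_eq_left times_divide_eq_right divide_divide_eq_left mult_ac)
  finally show ?thesis .
qed

text \<open>
  The substitution \<open>r = sqrt (1 + a)\<close>, which runs from \<open>1\<close> to \<open>2\<close>, makes both antiderivatives rational in \<open>r\<close>.
\<close>
lemma has_integral_mixture_weights:
  "((\<lambda>a. 1 / (2 * (1 + a) * sqrt (1 + a))) has_integral 1/2) {0..3::real}"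
  "((\<lambda>a. a / (1 + a) / (2 * (1 + a) * sqrt (1 + a))) has_integral 5/24) {0..3::real}"
proof -
  have s4: "sqrt 4 = 2" by (rule real_sqrt_unique) auto
  have "((\<lambda>a. 1 / (2 * (1 + a) * sqrt (1 + a))) has_integral (- 1 / sqrt (1 + 3) - (- 1 / sqrt (1 + 0)))) {0..3::real}"
    by (intro fundamental_theorem_of_calculus)
       (auto simp flip: has_real_derivative_iff_has_vector_derivative
          intro!: derivative_eq_intros simp: field_simps)
  then show "((\<lambda>a. 1 / (2 * (1 + a) * sqrt (1 + a))) has_integral 1/2) {0..3::real}"
    by (simp add: s4)
  have "((\<lambda>a. 1 / (3 * sqrt (1 + a) ^ 3) - 1 / sqrt (1 + a)) has_real_derivative
      a / (1 + a) / (2 * (1 + a) * sqrt (1 + a))) (at a within {0..3})" if "0 \<le> a" for a :: real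
  proof -
    define r where "r = sqrt (1 + a)"
    have r: "0 < r" "1 + a = r\<^sup>2" "a = r\<^sup>2 - 1" using that by (auto simp: r_def)
    have dr: "((\<lambda>a. sqrt (1 + a)) has_real_derivative 1 / (2 * r)) (at a within {0..3})"
      using that by (auto intro!: derivative_eq_intros simp: r_def field_simps)
    have "((\<lambda>r. 1 / (3 * r ^ 3) - 1 / r) has_real_derivative 1 / r\<^sup>2 - 1 / r ^ 4) (at r)"
      using r(1) by (auto intro!: derivative_eq_intros simp: field_simps power2_eq_square eval_nat_numeral)
    from DERIV_chain2[OF this[unfolded r_def] dr[unfolded r_def]]
    have "((\<lambda>a. 1 / (3 * sqrt (1 + a) ^ 3) - 1 / sqrt (1 + a)) has_real_derivative
        (1 / r\<^sup>2 - 1 / r ^ 4) * (1 / (2 * r))) (at a within {0..3})"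
      unfolding r_def .
    also have "(1 / r\<^sup>2 - 1 / r ^ 4) * (1 / (2 * r)) = (r\<^sup>2 - 1) / r\<^sup>2 / (2 * r\<^sup>2 * r)"
      using r(1) by (simp add: field_simps power2_eq_square eval_nat_numeral)
    also have "\<dots> = a / (1 + a) / (2 * (1 + a) * sqrt (1 + a))"
      by (simp only: r(2)[symmetric] r_def[symmetric] add_diff_cancel_left')
    finally show ?thesis .
  qed
  then have "((\<lambda>a. a / (1 + a) / (2 * (1 + a) * sqrt (1 + a))) has_integral
     ((1 / (3 * sqrt (1 + 3) ^ 3) - 1 / sqrt (1 + 3)) - (1 / (3 * sqrt (1 + 0) ^ 3) - 1 / sqrt (1 + 0)))) {0..3::real}"
    by (intro fundamental_theorem_of_calculus) (auto simp flip: has_real_derivative_iff_has_vector_derivative)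
  then show "((\<lambda>a. a / (1 + a) / (2 * (1 + a) * sqrt (1 + a))) has_integral 5/24) {0..3::real}"
    by (simp add: s4)
qed

text \<open>The mixture over \<open>a\<close> and the expectation over \<open>z\<close> are interchanged.\<close>
lemma expectation_shifted_stein:
  "(\<integral>z. stein (z + x) \<partial>std_normal) =
    (\<integral>a. indicator {0..3} a * (x * (exp (- (a / (1 + a) * x\<^sup>2 / 2)) / (2 * (1 + a) * sqrt (1 + a)))) \<partial>lborel)"
proof -
  interpret N: real_distribution std_normal by (rule real_distribution_std_normal)
  interpret P: pair_sigma_finite std_normal lborel ..
  let ?g = "\<lambda>z a. indicator {0..3} a * ((z + x) * exp (- (a * (z + x)\<^sup>2 / 2)) / 2)"
  have rep: "stein w = (\<integral>a. indicator {0..3} a * (w * exp (- (a * w\<^sup>2 / 2)) / 2) \<partial>lborel)" for w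
  proof -
    have "set_integrable lborel {0..3} (\<lambda>a. w * exp (- (a * w\<^sup>2 / 2)) / 2)"
      by (intro borel_integrable_atLeastAtMost' continuous_intros) auto
    from set_borel_integral_eq_integral(2)[OF this] integral_unique[OF stein_has_integral, of w]
    show ?thesis by (simp only: set_lebesgue_integral_def real_scaleR_def)
  qed
  have "(\<integral>z. stein (z + x) \<partial>std_normal) = (\<integral>z. (\<integral>a. ?g z a \<partial>lborel) \<partial>std_normal)"
    by (simp only: rep)
  also have "\<dots> = (\<integral>a. (\<integral>z. ?g z a \<partial>std_normal) \<partial>lborel)"
  proof (rule P.Fubini_integral[symmetric])
    show "integrable (std_normal \<Otimes>\<^sub>M lborel) (case_prod ?g)"
    proof (rule Bochner_Integration.integrable_bound)
      have "integrable std_normal (\<lambda>z. \<bar>z\<bar>)"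
        using integrable_std_normal_moment_abs[of 1] by (subst integrable_density) auto
      then have lin: "integrable std_normal (\<lambda>z. \<bar>z\<bar> + \<bar>x\<bar>)" by simp
      show "integrable (std_normal \<Otimes>\<^sub>M lborel) (\<lambda>(z, a). indicator {0..3::real} a * (\<bar>z\<bar> + \<bar>x\<bar>))"
      proof (rule P.Fubini_integrable)
        show "integrable std_normal
            (\<lambda>z. \<integral>a. norm (case (z, a) of (z, a) \<Rightarrow> indicator {0..3::real} a * (\<bar>z\<bar> + \<bar>x\<bar>)) \<partial>lborel)"
        proof -
          have "integrable std_normal (\<lambda>z. 3 * (\<bar>z\<bar> + \<bar>x\<bar>))"
            by (rule integrable_mult_right) (rule lin)
          then show ?thesis by (simp add: abs_mult distrib_left)
        qed
        have "(\<lambda>(z, a). indicator {0..3::real} a * (\<bar>z\<bar> + \<bar>x\<bar>)) \<in> borel_measurable (borel \<Otimes>\<^sub>M borel)"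
          by measurable
        then show "(\<lambda>(z, a). indicator {0..3::real} a * (\<bar>z\<bar> + \<bar>x\<bar>)) \<in> borel_measurable (std_normal \<Otimes>\<^sub>M lborel)"
          by (simp cong: measurable_cong_sets sets_pair_measure_cong)
      qed auto
      show "AE p in std_normal \<Otimes>\<^sub>M lborel. norm (case_prod ?g p) \<le> norm ((\<lambda>(z, a). indicator {0..3::real} a * (\<bar>z\<bar> + \<bar>x\<bar>)) p)"
      proof (intro AE_I2, clarify)
        fix z a :: real
        have "\<bar>z + x\<bar> * exp (- (a * (z + x)\<^sup>2 / 2)) / 2 \<le> (\<bar>z\<bar> + \<bar>x\<bar>) * 1 / 1" if "0 \<le> a"
          using that by (intro frac_le mult_mono abs_triangle_ineq) auto
        then show "norm (?g z a) \<le> norm (indicator {0..3} a * (\<bar>z\<bar> + \<bar>x\<bar>))"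
          by (auto simp: indicator_def abs_mult)
      qed
    qed measurable
  qed
  also have "\<dots> = (\<integral>a. indicator {0..3} a * (x * (exp (- (a / (1 + a) * x\<^sup>2 / 2)) / (2 * (1 + a) * sqrt (1 + a)))) \<partial>lborel)"
    by (intro Bochner_Integration.integral_cong refl)
       (auto simp: indicator_def expectation_shifted_gaussian_wave simp del: integral_divide_zero)
  finally show ?thesis .
qed

text \<open>Convexity of the exponential: on \<open>{- z..0}\<close> it lies below its chord.\<close>
lemma exp_chord_bound:
  fixes z :: real
  assumes "0 \<le> p" "p \<le> 1"
  shows "exp (- (p * z)) \<le> 1 - p * (1 - exp (- z))"
  using convex_onD[OF exp_convex, of p 0 "- z"] assms by (simp add: algebra_simps)

text \<open>
  The surplus is the integral of \<open>(1 - exp (- p * x\<^sup>2 / 2)) / (2 * (1 + a) * sqrt (1 + a))\<close> over \<open>a \<in> {0..3}\<close>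
  with \<open>p = a / (1 + a)\<close>. The chord bound replaces the exponent \<open>p\<close>, which is always below \<open>1\<close>, by a factor
  \<open>p\<close> in front of \<open>1 - exp (- x\<^sup>2 / 2)\<close>; nothing is lost to leading order for small \<open>x\<close>.
\<close>
lemma expectation_stein_test_std_normal:
  assumes "x \<noteq> 0"
  shows "5/24 * (1 - exp (- (1/2) * x\<^sup>2)) \<le> (\<integral>w. stein_test x w \<partial>std_normal)"
proof -
  interpret N: real_distribution std_normal by (rule real_distribution_std_normal)
  define l where "l = 1 - exp (- (x\<^sup>2 / 2))"
  let ?k = "\<lambda>a::real. 1 / (2 * (1 + a) * sqrt (1 + a))"
  have bounded: "integrable std_normal (\<lambda>z. stein (z + y))" for y
    by (rule N.integrable_const_bound[where B=2]) (auto simp: abs_stein_le)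
  have sq: "(\<integral>z. exp (- (3/2) * z\<^sup>2) \<partial>std_normal) = 1/2"
  proof -
    have s4: "sqrt 4 = 2" by (rule real_sqrt_unique) auto
    have "(\<integral>z. exp (- (3/2) * z\<^sup>2) \<partial>std_normal) = (\<integral>z. std_normal_density z * exp (- (3 * (z + 0)\<^sup>2 / 2)) \<partial>lborel)"
      by (subst integral_density) auto
    also have "\<dots> = (\<integral>z. 1 / 2 * normal_density 0 (1 / 2) z \<partial>lborel)"
      by (subst normal_density_tilt) (auto simp: s4)
    also have "\<dots> = 1 / 2" by simp
    finally show ?thesis .
  qed
  have "integrable std_normal (\<lambda>z. exp (- (3/2) * z\<^sup>2))"
    by (rule N.integrable_const_bound[where B=1]) auto
  then have first: "(\<integral>w. w * stein w \<partial>std_normal) = 1/2" and "integrable std_normal (\<lambda>w. w * stein w)"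
    using sq N.prob_space unfolding times_stein by auto
  have zero: "(\<integral>w. stein w \<partial>std_normal) = 0"
    using expectation_shifted_stein[of 0] by simp
  let ?h = "\<lambda>a. exp (- (a / (1 + a) * x\<^sup>2 / 2)) * ?k a"
  have si: "set_integrable lborel {0..3} ?h"
    by (intro borel_integrable_atLeastAtMost' continuous_intros) auto
  have "(\<integral>z. stein (z + x) \<partial>std_normal) = x * (LINT a:{0..3}|lborel. ?h a)"
    unfolding expectation_shifted_stein
    by (simp add: set_lebesgue_integral_def mult_ac flip: Bochner_Integration.integral_mult_right_zero)
  also have "(LINT a:{0..3}|lborel. ?h a) = integral {0..3} ?h"
    by (rule set_borel_integral_eq_integral(2)[OF si])
  finally have shifted: "(\<integral>z. stein (z + x) \<partial>std_normal) = x * integral {0..3} ?h" .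
  have distr: "(1 - p * l) * (1 / d) = 1 / d - l * (p / d)" for p d :: real
    by (simp add: diff_divide_distrib)
  have "integral {0..3} ?h \<le> 1/2 - l * (5/24)"
  proof (rule has_integral_le[OF integrable_integral[OF set_borel_integral_eq_integral(1)[OF si]]])
    show "((\<lambda>a. ?k a - l * (a / (1 + a) / (2 * (1 + a) * sqrt (1 + a)))) has_integral 1/2 - l * (5/24)) {0..3}"
      by (intro has_integral_diff has_integral_mult_right has_integral_mixture_weights)
    fix a :: real assume a: "a \<in> {0..3}"
    have "exp (- (a / (1 + a) * x\<^sup>2 / 2)) \<le> 1 - a / (1 + a) * l"
      using exp_chord_bound[of "a / (1 + a)" "x\<^sup>2 / 2"] a by (simp add: l_def)
    then have "?h a \<le> (1 - a / (1 + a) * l) * ?k a"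
      using a by (intro mult_right_mono) auto
    also have "(1 - a / (1 + a) * l) * ?k a = ?k a - l * (a / (1 + a) / (2 * (1 + a) * sqrt (1 + a)))"
      by (simp only: distr)
    finally show "?h a \<le> ?k a - l * (a / (1 + a) / (2 * (1 + a) * sqrt (1 + a)))" .
  qed
  moreover have "(\<integral>w. stein_test x w \<partial>std_normal) = 1/2 - integral {0..3} ?h"
    unfolding stein_test_def
    using first zero shifted bounded[of x] bounded[of 0] \<open>integrable std_normal (\<lambda>w. w * stein w)\<close> assms
    by simp
  moreover have "5/24 * (1 - exp (- (1/2) * x\<^sup>2)) = l * (5/24)" by (simp add: l_def)
  ultimately show ?thesis by linarith
qed

section \<open>Sums of independent variables\<close>

context prob_space
begin

lemma expectation_abs_le_sqrt:
  assumes [measurable]: "X \<in> borel_measurable M" and sq: "integrable M (\<lambda>\<omega>. (X \<omega>)\<^sup>2 :: real)"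
  shows "expectation (\<lambda>\<omega>. \<bar>X \<omega>\<bar>) \<le> sqrt (expectation (\<lambda>\<omega>. (X \<omega>)\<^sup>2))"
proof (rule real_le_rsqrt)
  have "integrable M X" using sq by (rule square_integrable_imp_integrable[rotated]) auto
  then have "0 \<le> expectation (\<lambda>\<omega>. \<bar>X \<omega>\<bar>\<^sup>2) - (expectation (\<lambda>\<omega>. \<bar>X \<omega>\<bar>))\<^sup>2"
    using sq variance_positive[of "\<lambda>\<omega>. \<bar>X \<omega>\<bar>"] by (subst (asm) variance_eq) auto
  then show "(expectation (\<lambda>\<omega>. \<bar>X \<omega>\<bar>))\<^sup>2 \<le> expectation (\<lambda>\<omega>. (X \<omega>)\<^sup>2)" by simp
qed

lemma integrable_stein_shift:
  assumes [measurable]: "V \<in> borel_measurable M"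
  shows "integrable M (\<lambda>\<omega>. stein (V \<omega>))" "integrable M (\<lambda>\<omega>. stein (V \<omega> + x))"
  by (rule integrable_const_bound[where B=2]; simp add: abs_stein_le)+

lemma abs_expectation_stein_difference_le:
  fixes V :: "'a \<Rightarrow> real"
  shows "\<bar>stein s - stein t\<bar> \<le> 4"
    and "V \<in> borel_measurable M \<Longrightarrow> \<bar>expectation (\<lambda>\<omega>. stein (V \<omega> + x) - stein (V \<omega>))\<bar> \<le> 4"
proof -
  show diff: "\<bar>stein s - stein t\<bar> \<le> 4" for s t
    using abs_stein_le[of s] abs_stein_le[of t] by linarith
  assume [measurable]: "V \<in> borel_measurable M"
  have "\<bar>expectation (\<lambda>\<omega>. stein (V \<omega> + x) - stein (V \<omega>))\<bar>
      \<le> expectation (\<lambda>\<omega>. \<bar>stein (V \<omega> + x) - stein (V \<omega>)\<bar>)"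
    by (rule integral_abs_bound)
  also have "\<dots> \<le> expectation (\<lambda>\<omega>. 4)"
    by (intro integral_mono integrable_const integrable_const_bound[where B=4]) (auto simp: diff)
  finally show "\<bar>expectation (\<lambda>\<omega>. stein (V \<omega> + x) - stein (V \<omega>))\<bar> \<le> 4"
    by (simp add: prob_space)
qed

text \<open>
  In the application \<open>X\<close> is one summand and \<open>V\<close> is the sum of the others. As \<open>X\<close> is centred and independent of
  \<open>V\<close>, one may subtract \<open>stein V\<close> for free, and then treat \<open>X\<close> as a fixed number \<open>x\<close> inside the expectation over
  \<open>V\<close>. Finally \<open>V\<close> is replaced by the full sum \<open>V + X\<close>, at the cost of the last term, so that the law in \<open>H\<close>
  no longer depends on which summand was singled out.
\<close>
lemma expectation_times_stein_le:
  fixes X V :: "'a \<Rightarrow> real"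
  assumes indep: "indep_var borel X borel V"
    and sq: "integrable M (\<lambda>\<omega>. (X \<omega>)\<^sup>2)" and mean: "expectation X = 0"
  defines "H \<equiv> \<lambda>x. expectation (\<lambda>\<omega>. stein (V \<omega> + X \<omega> + x) - stein (V \<omega> + X \<omega>))"
  shows "expectation (\<lambda>\<omega>. X \<omega> * stein (V \<omega> + X \<omega>))
    \<le> expectation (\<lambda>\<omega>. X \<omega> * H (X \<omega>)) + 9 * (expectation (\<lambda>\<omega>. \<bar>X \<omega>\<bar>) * expectation (\<lambda>\<omega>. (X \<omega>)\<^sup>2))"
proof -
  have [measurable]: "X \<in> borel_measurable M" "V \<in> borel_measurable M"
    using indep_var_rv1[OF indep] indep_var_rv2[OF indep] by auto
  have X: "integrable M X" using sq by (rule square_integrable_imp_integrable[rotated]) auto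
  have pair: "distr M borel X \<Otimes>\<^sub>M distr M borel V = distr M (borel \<Otimes>\<^sub>M borel) (\<lambda>\<omega>. (X \<omega>, V \<omega>))"
    using indep by (simp add: indep_var_distribution_eq)
  interpret X: prob_space "distr M borel X" by (rule prob_space_distr) simp
  interpret V: prob_space "distr M borel V" by (rule prob_space_distr) simp
  interpret P: pair_sigma_finite "distr M borel X" "distr M borel V" ..
  have int: "integrable M (\<lambda>\<omega>. X \<omega> * f \<omega>)" if [measurable]: "f \<in> borel_measurable M" and "\<And>\<omega>. \<bar>f \<omega>\<bar> \<le> 4" for f
  proof (rule Bochner_Integration.integrable_bound)
    show "integrable M (\<lambda>\<omega>. 4 * X \<omega>)" using X by simp
    show "AE \<omega> in M. norm (X \<omega> * f \<omega>) \<le> norm (4 * X \<omega>)"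
      using that(2) by (auto simp: abs_mult mult.commute[of 4] intro!: mult_left_mono)
  qed measurable
  have Hb: "\<bar>H x\<bar> \<le> 4" for x
    unfolding H_def by (rule abs_expectation_stein_difference_le(2)) simp
  have [measurable]: "H \<in> borel_measurable borel" unfolding H_def by measurable
  have "expectation (\<lambda>\<omega>. X \<omega> * stein (V \<omega>)) = expectation X * expectation (\<lambda>\<omega>. stein (V \<omega>))"
    using indep_var_compose[OF indep, of id borel stein borel] X integrable_stein_shift(1)[of V]
    by (intro indep_var_lebesgue_integral) (auto simp: o_def id_def)
  then have "expectation (\<lambda>\<omega>. X \<omega> * stein (V \<omega>)) = 0" using mean by simp
  moreover have "integrable M (\<lambda>\<omega>. X \<omega> * stein (V \<omega> + X \<omega>))" "integrable M (\<lambda>\<omega>. X \<omega> * stein (V \<omega>))"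
    by (intro int; use abs_stein_le in \<open>fastforce intro: order_trans\<close>)+
  ultimately have "expectation (\<lambda>\<omega>. X \<omega> * stein (V \<omega> + X \<omega>))
      = expectation (\<lambda>\<omega>. X \<omega> * (stein (V \<omega> + X \<omega>) - stein (V \<omega>)))"
    by (simp add: right_diff_distrib)
  also have "\<dots> = (\<integral>p. (case p of (x, v) \<Rightarrow> x * (stein (v + x) - stein v))
      \<partial>(distr M borel X \<Otimes>\<^sub>M distr M borel V))"
    unfolding pair by (subst integral_distr) auto
  also have "\<dots> = (\<integral>x. (\<integral>v. x * (stein (v + x) - stein v) \<partial>distr M borel V) \<partial>distr M borel X)"
  proof -
    have "integrable (distr M borel X \<Otimes>\<^sub>M distr M borel V) (\<lambda>(x, v). x * (stein (v + x) - stein v))"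
      unfolding pair by (subst integrable_distr_eq) (auto intro!: int simp: abs_expectation_stein_difference_le(1))
    from P.integral_fst'[OF this] show ?thesis by simp
  qed
  also have "\<dots> = expectation (\<lambda>\<omega>. \<integral>v. X \<omega> * (stein (v + X \<omega>) - stein v) \<partial>distr M borel V)"
    by (subst integral_distr) auto
  also have "\<dots> = expectation (\<lambda>\<omega>. X \<omega> * (\<integral>\<omega>'. (stein (V \<omega>' + X \<omega>) - stein (V \<omega>')) \<partial>M))"
    by (intro Bochner_Integration.integral_cong refl) (subst integral_distr, auto)
  also have "\<dots> \<le> expectation (\<lambda>\<omega>. X \<omega> * H (X \<omega>) + 9 * (expectation (\<lambda>\<omega>. \<bar>X \<omega>\<bar>) * (X \<omega>)\<^sup>2))"
  proof (rule integral_mono)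
    let ?G = "\<lambda>x. \<integral>\<omega>'. (stein (V \<omega>' + x) - stein (V \<omega>')) \<partial>M"
    have G4: "\<bar>?G x\<bar> \<le> 4" for x
      by (rule abs_expectation_stein_difference_le(2)) simp
    show "integrable M (\<lambda>\<omega>. X \<omega> * ?G (X \<omega>))"
      by (intro int G4) measurable
    show "integrable M (\<lambda>\<omega>. X \<omega> * H (X \<omega>) + 9 * (expectation (\<lambda>\<omega>. \<bar>X \<omega>\<bar>) * (X \<omega>)\<^sup>2))"
      using sq by (intro Bochner_Integration.integrable_add int Hb) auto
    fix \<omega>
    have "\<bar>?G x - H x\<bar> \<le> 9 * \<bar>x\<bar> * expectation (\<lambda>\<omega>. \<bar>X \<omega>\<bar>)" for x
    proof -
      have i: "integrable M (\<lambda>\<omega>. stein (V \<omega> + x) - stein (V \<omega>))"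
        by (intro Bochner_Integration.integrable_diff integrable_stein_shift(1)[of V] integrable_stein_shift(2)[of V]) measurable
      have j: "integrable M (\<lambda>\<omega>. stein (V \<omega> + X \<omega> + x) - stein (V \<omega> + X \<omega>))"
        by (intro Bochner_Integration.integrable_diff integrable_stein_shift(1)[of "\<lambda>\<omega>. V \<omega> + X \<omega>"]
              integrable_stein_shift(2)[of "\<lambda>\<omega>. V \<omega> + X \<omega>"]) measurable
      have eq: "?G x - H x = expectation (\<lambda>\<omega>. (stein (V \<omega> + x) - stein (V \<omega>)) - (stein (V \<omega> + X \<omega> + x) - stein (V \<omega> + X \<omega>)))"
        unfolding H_def
        by (rule Bochner_Integration.integral_diff[OF i j, symmetric])
      have "\<bar>?G x - H x\<bar> \<le> expectation (\<lambda>\<omega>. \<bar>(stein (V \<omega> + x) - stein (V \<omega>)) - (stein (V \<omega> + X \<omega> + x) - stein (V \<omega> + X \<omega>))\<bar>)"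
        unfolding eq by (rule integral_abs_bound)
      also have "\<dots> \<le> expectation (\<lambda>\<omega>. 9 * \<bar>x\<bar> * \<bar>X \<omega>\<bar>)"
      proof (rule integral_mono)
        show "integrable M (\<lambda>\<omega>. \<bar>(stein (V \<omega> + x) - stein (V \<omega>)) - (stein (V \<omega> + X \<omega> + x) - stein (V \<omega> + X \<omega>))\<bar>)"
          by (rule integrable_abs[OF Bochner_Integration.integrable_diff[OF i j]])
        show "integrable M (\<lambda>\<omega>. 9 * \<bar>x\<bar> * \<bar>X \<omega>\<bar>)" using X by simp
        show "\<bar>(stein (V \<omega> + x) - stein (V \<omega>)) - (stein (V \<omega> + X \<omega> + x) - stein (V \<omega> + X \<omega>))\<bar>
            \<le> 9 * \<bar>x\<bar> * \<bar>X \<omega>\<bar>" for \<omega>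
          using stein_mixed_difference[of "V \<omega>" x "X \<omega>"] by (simp only: mult.assoc)
      qed
      finally show ?thesis by simp
    qed
    then have "\<bar>X \<omega>\<bar> * \<bar>?G (X \<omega>) - H (X \<omega>)\<bar> \<le> \<bar>X \<omega>\<bar> * (9 * \<bar>X \<omega>\<bar> * expectation (\<lambda>\<omega>. \<bar>X \<omega>\<bar>))"
      by (intro mult_left_mono) auto
    also have "\<dots> = 9 * (expectation (\<lambda>\<omega>. \<bar>X \<omega>\<bar>) * (X \<omega>)\<^sup>2)"
      by (simp add: power2_eq_square)
    finally show "X \<omega> * ?G (X \<omega>) \<le> X \<omega> * H (X \<omega>) + 9 * (expectation (\<lambda>\<omega>. \<bar>X \<omega>\<bar>) * (X \<omega>)\<^sup>2)"
      unfolding abs_mult[symmetric] by (simp add: right_diff_distrib abs_le_iff)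
  qed
  also have "\<dots> = expectation (\<lambda>\<omega>. X \<omega> * H (X \<omega>)) + 9 * (expectation (\<lambda>\<omega>. \<bar>X \<omega>\<bar>) * expectation (\<lambda>\<omega>. (X \<omega>)\<^sup>2))"
    using sq int[of "\<lambda>\<omega>. H (X \<omega>)"] Hb by (subst Bochner_Integration.integral_add) auto
  finally show ?thesis .
qed

text \<open>
  The normal surplus, transported to \<open>W\<close> and multiplied by \<open>x\<^sup>2\<close>: the form in which it is averaged over the law of
  a summand.
\<close>
lemma stein_difference_bound:
  assumes [measurable]: "W \<in> borel_measurable M"
    and K: "\<And>t. \<bar>cdf std_normal t - prob {\<omega> \<in> space M. W \<omega> \<le> t}\<bar> \<le> K"
  shows "x * expectation (\<lambda>\<omega>. stein (W \<omega> + x) - stein (W \<omega>))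
    \<le> x\<^sup>2 * (expectation (\<lambda>\<omega>. W \<omega> * stein (W \<omega>)) + 101/16 * K)
       - 5/24 * (x\<^sup>2 * (1 - exp (- (1/2) * x\<^sup>2)))"
proof (cases "x = 0")
  case False
  let ?H = "expectation (\<lambda>\<omega>. stein (W \<omega> + x) - stein (W \<omega>))"
  have W: "real_distribution (distr M borel W)"
    by (rule real_distribution_distr) simp
  have cdf: "cdf (distr M borel W) t = prob {\<omega> \<in> space M. W \<omega> \<le> t}" for t
    unfolding cdf_def by (subst measure_distr) (auto intro!: arg_cong[where f=prob])
  have "\<bar>(\<integral>w. stein_test x w \<partial>std_normal) - (\<integral>w. stein_test x w \<partial>distr M borel W)\<bar> \<le> K * (101/16)"
    by (rule expectation_diff_le_cdf_distance[OF real_distribution_std_normal W _ stein_test_deriv isCont_stein_test' integrable_stein_test'[OF False]])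
       (simp add: cdf K)
  moreover have "(\<integral>w. stein_test x w \<partial>distr M borel W) = expectation (\<lambda>\<omega>. W \<omega> * stein (W \<omega>)) - ?H / x"
  proof -
    have "integrable M (\<lambda>\<omega>. W \<omega> * stein (W \<omega>))"
      by (rule integrable_const_bound[where B=1]) (auto simp: times_stein)
    moreover have "(\<integral>w. stein_test x w \<partial>distr M borel W)
        = expectation (\<lambda>\<omega>. W \<omega> * stein (W \<omega>) - (stein (W \<omega> + x) - stein (W \<omega>)) / x)"
      unfolding stein_test_def by (subst integral_distr) auto
    ultimately show ?thesis using integrable_stein_shift(1)[of W] integrable_stein_shift(2)[of W x] by simp
  qed
  moreover note expectation_stein_test_std_normal[OF False]
  ultimately have "?H / x \<le> expectation (\<lambda>\<omega>. W \<omega> * stein (W \<omega>)) + 101/16 * K - 5/24 * (1 - exp (- (1/2) * x\<^sup>2))"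
    by linarith
  then have "x\<^sup>2 * (?H / x) \<le> x\<^sup>2 * (expectation (\<lambda>\<omega>. W \<omega> * stein (W \<omega>)) + 101/16 * K - 5/24 * (1 - exp (- (1/2) * x\<^sup>2)))"
    by (rule mult_left_mono) simp
  moreover have "x\<^sup>2 * (?H / x) = x * ?H" using False by (simp add: power2_eq_square)
  ultimately show ?thesis by (simp add: right_diff_distrib mult_ac)
qed simp

text \<open>
  Summing over the summands \<open>X k\<close>, whose variances \<open>s k\<close> add up to \<open>1\<close>, the unknown \<open>E\<close> appears on both sides
  with the same weight and cancels.
\<close>
lemma relaxed_Lindeberg_sum_le:
  fixes X :: "'i \<Rightarrow> 'a \<Rightarrow> real"
  assumes fin: "finite I" and indep: "indep_vars (\<lambda>_. borel) X I"
    and sq: "\<And>k. k \<in> I \<Longrightarrow> integrable M (\<lambda>\<omega>. (X k \<omega>)\<^sup>2)"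
    and mean: "\<And>k. k \<in> I \<Longrightarrow> expectation (X k) = 0"
    and total: "(\<Sum>k\<in>I. expectation (\<lambda>\<omega>. (X k \<omega>)\<^sup>2)) = 1"
    and small: "\<And>k. k \<in> I \<Longrightarrow> expectation (\<lambda>\<omega>. (X k \<omega>)\<^sup>2) \<le> v"
    and K: "\<And>t. \<bar>cdf std_normal t - prob {\<omega> \<in> space M. (\<Sum>k\<in>I. X k \<omega>) \<le> t}\<bar> \<le> K"
  shows "(\<Sum>k\<in>I. expectation (\<lambda>\<omega>. (X k \<omega>)\<^sup>2 * (1 - exp (- (1/2) * (X k \<omega>)\<^sup>2))))
    \<le> 303/10 * K + 216/5 * sqrt v"
proof -
  define W where "W \<omega> = (\<Sum>k\<in>I. X k \<omega>)" for \<omega>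
  define H where "H x = expectation (\<lambda>\<omega>. stein (W \<omega> + x) - stein (W \<omega>))" for x
  define E where "E = expectation (\<lambda>\<omega>. W \<omega> * stein (W \<omega>))"
  define s where "s k = expectation (\<lambda>\<omega>. (X k \<omega>)\<^sup>2)" for k
  define L where "L k = expectation (\<lambda>\<omega>. (X k \<omega>)\<^sup>2 * (1 - exp (- (1/2) * (X k \<omega>)\<^sup>2)))" for k
  have meas: "X k \<in> borel_measurable M" if "k \<in> I" for k
    using indep that by (auto simp: indep_vars_def)
  have W[measurable]: "W \<in> borel_measurable M"
    unfolding W_def[abs_def] using meas by (intro borel_measurable_sum)
  have Xi: "integrable M (X k)" if "k \<in> I" for k
    using square_integrable_imp_integrable[OF meas[OF that] sq[OF that]] .
  \<comment> \<open>independence, the centring of \<open>X k\<close> and the normal surplus, for one summand\<close>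
  have per_term: "expectation (\<lambda>\<omega>. X k \<omega> * stein (W \<omega>)) \<le> s k * (E + 101/16 * K) - 5/24 * L k + 9 * (sqrt v * s k)"
    if k: "k \<in> I" for k
  proof -
    have [measurable]: "X k \<in> borel_measurable M" by (rule meas[OF k])
    define V where "V \<omega> = (\<Sum>j\<in>I - {k}. X j \<omega>)" for \<omega>
    have V: "indep_var borel (X k) borel V"
      unfolding V_def[abs_def]
      using indep_vars_sum[of "I - {k}" k X] fin indep k by (simp add: insert_absorb)
    have WV: "W \<omega> = V \<omega> + X k \<omega>" for \<omega>
      unfolding W_def V_def using fin k by (subst sum.remove[of I k]) auto
    have "expectation (\<lambda>\<omega>. X k \<omega> * stein (W \<omega>))
        \<le> expectation (\<lambda>\<omega>. X k \<omega> * H (X k \<omega>)) + 9 * (expectation (\<lambda>\<omega>. \<bar>X k \<omega>\<bar>) * s k)"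
      using expectation_times_stein_le[OF V sq[OF k] mean[OF k]] unfolding H_def WV s_def .
    moreover have "expectation (\<lambda>\<omega>. \<bar>X k \<omega>\<bar>) * s k \<le> sqrt v * s k"
    proof (rule mult_right_mono)
      have "expectation (\<lambda>\<omega>. \<bar>X k \<omega>\<bar>) \<le> sqrt (s k)"
        unfolding s_def using sq[OF k] by (intro expectation_abs_le_sqrt) auto
      also have "\<dots> \<le> sqrt v" using small[OF k] by (simp add: s_def)
      finally show "expectation (\<lambda>\<omega>. \<bar>X k \<omega>\<bar>) \<le> sqrt v" .
      show "0 \<le> s k" by (simp add: s_def)
    qed
    moreover have "expectation (\<lambda>\<omega>. X k \<omega> * H (X k \<omega>)) \<le> s k * (E + 101/16 * K) - 5/24 * L k"
    proof -
      have [measurable]: "H \<in> borel_measurable borel" unfolding H_def[abs_def] by measurable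
      have Hb: "\<bar>H x\<bar> \<le> 4" for x
        unfolding H_def by (rule abs_expectation_stein_difference_le(2)) simp
      have XH: "integrable M (\<lambda>\<omega>. X k \<omega> * H (X k \<omega>))"
        by (rule Bochner_Integration.integrable_bound[where f="\<lambda>\<omega>. 4 * X k \<omega>"])
           (auto simp: abs_mult mult.commute[of 4] intro!: mult_left_mono Xi[OF k] Hb)
      have Li: "integrable M (\<lambda>\<omega>. (X k \<omega>)\<^sup>2 * (1 - exp (- (1/2) * (X k \<omega>)\<^sup>2)))"
        by (rule Bochner_Integration.integrable_bound[OF sq[OF k]])
           (auto simp: abs_mult intro!: mult_left_le)
      have "expectation (\<lambda>\<omega>. X k \<omega> * H (X k \<omega>))
          \<le> expectation (\<lambda>\<omega>. (X k \<omega>)\<^sup>2 * (E + 101/16 * K) - 5/24 * ((X k \<omega>)\<^sup>2 * (1 - exp (- (1/2) * (X k \<omega>)\<^sup>2))))"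
        using K sq[OF k] Li XH unfolding H_def E_def
        by (intro integral_mono stein_difference_bound[OF W])
           (auto simp: W_def)
      also have "\<dots> = s k * (E + 101/16 * K) - 5/24 * L k"
        unfolding s_def L_def using sq[OF k] Li by (subst Bochner_Integration.integral_diff) auto
      finally show ?thesis .
    qed
    ultimately show ?thesis by linarith
  qed
  have "E = (\<Sum>k\<in>I. expectation (\<lambda>\<omega>. X k \<omega> * stein (W \<omega>)))"
  proof -
    have "integrable M (\<lambda>\<omega>. X k \<omega> * stein (W \<omega>))" if k: "k \<in> I" for k
    proof -
      have [measurable]: "X k \<in> borel_measurable M" by (rule meas[OF k])
      show ?thesis
        by (rule Bochner_Integration.integrable_bound[where f="\<lambda>\<omega>. 2 * X k \<omega>"])
           (auto simp: abs_mult mult.commute[of 2] intro!: mult_left_mono Xi[OF k] abs_stein_le)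
    qed
    moreover have "E = expectation (\<lambda>\<omega>. \<Sum>k\<in>I. X k \<omega> * stein (W \<omega>))"
      unfolding E_def by (simp add: W_def sum_distrib_right)
    ultimately show ?thesis by simp
  qed
  also have "\<dots> \<le> (\<Sum>k\<in>I. s k * (E + 101/16 * K) - 5/24 * L k + 9 * (sqrt v * s k))"
    by (intro sum_mono per_term)
  also have "\<dots> = (\<Sum>k\<in>I. s k) * (E + 101/16 * K) - 5/24 * (\<Sum>k\<in>I. L k) + 9 * (sqrt v * (\<Sum>k\<in>I. s k))"
    by (simp add: sum.distrib sum_subtractf sum_distrib_left sum_distrib_right)
  also have "(\<Sum>k\<in>I. s k) = 1" using total by (simp add: s_def)
  finally have "(\<Sum>k\<in>I. L k) \<le> 303/10 * K + 216/5 * sqrt v" by simp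
  then show ?thesis by (simp add: L_def)
qed

end

section \<open>The limit\<close>

theorem theorem3p6:
  shows "\<exists>C::real. 0 < C \<and> C \<le> 30.3 \<and>
    (\<forall>(M :: nat \<Rightarrow> 'a measure) X (N :: 'b measure) \<xi>.
       standard_triangular_array M X \<longrightarrow>
       feller_negligible M X \<longrightarrow>
       prob_space N \<longrightarrow>
       distributed N lborel \<xi> (\<lambda>x. ennreal (std_normal_density x)) \<longrightarrow>
       relaxed_Lin_half M X \<le>
         ereal C * limsup (\<lambda>n. ereal (kolmogorov_distance N \<xi> (M n) (\<lambda>\<omega>. \<Sum>k=1..n. X n k \<omega>))))"
proof (intro exI[of _ "303/10"] conjI allI impI)
  fix M :: "nat \<Rightarrow> 'a measure" and X :: "nat \<Rightarrow> nat \<Rightarrow> 'a \<Rightarrow> real" and N :: "'b measure" and \<xi> :: "'b \<Rightarrow> real"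
  assume array: "standard_triangular_array M X" and feller: "feller_negligible M X"
    and N: "prob_space N" and normal: "distributed N lborel \<xi> (\<lambda>x. ennreal (std_normal_density x))"
  define K where "K n = kolmogorov_distance N \<xi> (M n) (\<lambda>\<omega>. \<Sum>k=1..n. X n k \<omega>)" for n
  define v where "v n = (MAX k\<in>{1..n}. (\<integral>\<omega>. (X n k \<omega>)\<^sup>2 \<partial>M n))" for n
  define S where "S n = (\<Sum>k=1..n. (\<integral>\<omega>. (X n k \<omega>)\<^sup>2 * (1 - exp (- (1/2) * (X n k \<omega>)\<^sup>2)) \<partial>M n))" for n
  interpret N: prob_space N by (rule N)
  have \<xi>[measurable]: "\<xi> \<in> borel_measurable N"
    using distributed_measurable[OF normal] by simp
  have cdf_normal: "cdf std_normal t = N.prob {\<omega> \<in> space N. \<xi> \<omega> \<le> t}" for t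
  proof -
    have "std_normal = distr N lborel \<xi>"
      using distributed_distr_eq_density[OF normal] by simp
    then show ?thesis
      unfolding cdf_def by (simp add: measure_distr) (auto intro!: arg_cong[where f=N.prob])
  qed
  have row: "S n \<le> 303/10 * K n + 216/5 * sqrt (v n)" if n: "1 \<le> n" for n
  proof -
    interpret Mn: prob_space "M n"
      using array n by (auto simp: standard_triangular_array_def)
    have dist: "\<bar>N.prob {\<omega> \<in> space N. \<xi> \<omega> \<le> t} - Mn.prob {\<omega> \<in> space (M n). (\<Sum>k=1..n. X n k \<omega>) \<le> t}\<bar> \<le> K n" for t
      unfolding K_def kolmogorov_distance_def
    proof (rule cSUP_upper)
      show "bdd_above (range (\<lambda>x. \<bar>N.prob {\<omega> \<in> space N. \<xi> \<omega> \<le> x} - Mn.prob {\<omega> \<in> space (M n). (\<Sum>k=1..n. X n k \<omega>) \<le> x}\<bar>))"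
      proof (rule bdd_aboveI2)
        fix x
        show "\<bar>N.prob {\<omega> \<in> space N. \<xi> \<omega> \<le> x} - Mn.prob {\<omega> \<in> space (M n). (\<Sum>k=1..n. X n k \<omega>) \<le> x}\<bar> \<le> 1"
          using N.prob_le_1 Mn.prob_le_1 measure_nonneg by (smt (verit))
      qed
    qed simp
    show ?thesis
      unfolding S_def
    proof (rule Mn.relaxed_Lindeberg_sum_le)
      show "(\<integral>\<omega>. (X n k \<omega>)\<^sup>2 \<partial>M n) \<le> v n" if "k \<in> {1..n}" for k
        unfolding v_def using that by (intro Max_ge) auto
    qed (use array n dist in \<open>auto simp: standard_triangular_array_def cdf_normal\<close>)
  qed
  have "relaxed_Lin_half M X = limsup (\<lambda>n. ereal (S n))"
    by (simp add: relaxed_Lin_half_def S_def)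
  also have "\<dots> \<le> limsup (\<lambda>n. ereal (216/5 * sqrt (v n)) + ereal (303/10 * K n))"
    using row by (intro Limsup_mono eventually_mono[OF eventually_ge_at_top[of 1]]) (simp add: add.commute)
  also have "\<dots> = 0 + limsup (\<lambda>n. ereal (303/10 * K n))"
  proof (rule ereal_limsup_lim_add)
    have "v \<longlonglongrightarrow> 0" using feller by (simp add: feller_negligible_def v_def[abs_def])
    then have "(\<lambda>n. 216/5 * sqrt (v n)) \<longlonglongrightarrow> 216/5 * sqrt 0" by (intro tendsto_intros)
    then have "(\<lambda>n. ereal (216/5 * sqrt (v n))) \<longlonglongrightarrow> ereal 0"
      by (intro tendsto_ereal) simp
    then show "(\<lambda>n. ereal (216/5 * sqrt (v n))) \<longlonglongrightarrow> 0" by (simp add: zero_ereal_def)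
  qed simp
  also have "\<dots> = ereal (303/10) * limsup (\<lambda>n. ereal (K n))"
    using limsup_ereal_mult_left[of "303/10" "\<lambda>n. ereal (K n)"] by simp
  finally show "relaxed_Lin_half M X \<le> ereal (303/10) *
      limsup (\<lambda>n. ereal (kolmogorov_distance N \<xi> (M n) (\<lambda>\<omega>. \<Sum>k=1..n. X n k \<omega>)))"
    by (simp add: K_def)
qed simp_all

end
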